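(* Let $k\ge 1$ be an integer and let $(\rho_n\colon\mathbf{Z}\to\mathrm{SO}_0(1,k+1))_{n\in\mathbf{N}}$ be a sequence of convex-cocompact representations such that the subgroups $\rho_n(\mathbf{Z})$ converge geometrically to a discrete group $\Gamma_G$. Then the rank of $\Gamma_G$ is at most $\lfloor k/2\rfloor+1$.
   Context: $\mathrm{SO}_0(1,k+1)$ is the identity component of the group of real $(k+2)\times(k+2)$ matrices of determinant $1$ preserving a quadratic form of signature $(1,k+1)$; it acts by isometries on real hyperbolic space $\mathbb{H}^{k+1}_{\mathbf{R}}$. An element is loxodromic if it has no fixed point in $\mathbb{H}^{k+1}_{\mathbf{R}}$ and exactly two fixed points in the boundary. A representation $\rho\colon\mathbf{Z}\to\mathrm{SO}_0(1,k+1)$ is convex-cocompact if $\rho(1)$ is loxodromic. A sequence of closed subgroups $H_n$ of a Lie group $\mathsf{G}$ converges geometrically to a closed subgroup $H$ if it converges in the Chabauty topology: (1) every $h\in H$ is a limit of some sequence $h_n\in H_n$; (2) if $h_{n_i}\in H_{n_i}$ for a subsequence and $h_{n_i}\to\hat h$ in $\mathsf{G}$, then $\hat h\in H$. A geometric limit of abelian groups is abelian; rank means the rank of an abelian group (the maximal number of $\mathbf{Z}$-linearly independent elements). *)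

theory Defs
  imports "HOL-Analysis.Analysis" "HOL-Algebra.Elementary_Groups" "HOL-Algebra.FiniteProduct"
begin

text \<open>
  The index type \<open>'n option\<close> has one timelike coordinate \<open>None\<close> and \<open>CARD('n)\<close> spacelike
  coordinates. With \<open>CARD('n) = k + 1\<close> the form below has signature \<open>(1, k + 1)\<close> on
  a space of dimension \<open>k + 2\<close>, and hyperbolic space has dimension \<open>k + 1\<close>.
\<close>

definition lorentz_form :: "real ^ ('n::finite option) \<Rightarrow> real" where
  "lorentz_form x = (x $ None)\<^sup>2 - (\<Sum>i\<in>UNIV. (x $ Some i)\<^sup>2)"

definition SO_lorentz :: "(real ^ ('n::finite option) ^ ('n option)) set" where
  "SO_lorentz = {A. det A = 1 \<and> (\<forall>x. lorentz_form (A *v x) = lorentz_form x)}"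

definition SO0 :: "(real ^ ('n::finite option) ^ ('n option)) monoid" where
  "SO0 = \<lparr>carrier = connected_component_set SO_lorentz (mat 1), mult = (\<lambda>A B. A ** B), one = mat 1\<rparr>"

definition hyperbolic_space :: "(real ^ ('n::finite option)) set" where
  "hyperbolic_space = {x. lorentz_form x = 1 \<and> x $ None > 0}"

text \<open>The boundary at infinity is the set of isotropic lines.\<close>

definition hyperbolic_boundary :: "(real ^ ('n::finite option)) set set" where
  "hyperbolic_boundary = {span {v} | v. v \<noteq> 0 \<and> lorentz_form v = 0}"

definition loxodromic :: "real ^ ('n::finite option) ^ ('n option) \<Rightarrow> bool" where
  "loxodromic A \<longleftrightarrow>
     A \<in> carrier SO0 \<and>
     \<not> (\<exists>x\<in>hyperbolic_space. A *v x = x) \<and>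
     card {L \<in> hyperbolic_boundary. (\<lambda>x. A *v x) ` L = L} = 2"

definition convex_cocompact :: "(int \<Rightarrow> real ^ ('n::finite option) ^ ('n option)) \<Rightarrow> bool" where
  "convex_cocompact \<rho> \<longleftrightarrow> \<rho> \<in> hom integer_group SO0 \<and> loxodromic (\<rho> 1)"

definition closed_subgroup :: "'a::topological_space set \<Rightarrow> ('a, 'b) monoid_scheme \<Rightarrow> bool" where
  "closed_subgroup H G \<longleftrightarrow> subgroup H G \<and> closedin (top_of_set (carrier G)) H"

definition converges_geometrically ::
    "('a::topological_space, 'b) monoid_scheme \<Rightarrow> (nat \<Rightarrow> 'a set) \<Rightarrow> 'a set \<Rightarrow> bool" where
  "converges_geometrically G H L \<longleftrightarrow>
     (\<forall>n. closed_subgroup (H n) G) \<and> closed_subgroup L G \<and>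
     (\<forall>h\<in>L. \<exists>s. (\<forall>n. s n \<in> H n) \<and> s \<longlonglongrightarrow> h) \<and>
     (\<forall>r s h. strict_mono r \<and> (\<forall>i. s i \<in> H (r i)) \<and> h \<in> carrier G \<and> s \<longlonglongrightarrow> h \<longrightarrow> h \<in> L)"

text \<open>
  Independence over the integers, written multiplicatively; \<open>finprod\<close> and hence the next two
  definitions are meaningful for abelian \<open>G\<close>. The rank takes values in \<open>enat\<close>, so that
  unbounded families of independent elements give rank infinity.
\<close>

definition int_independent :: "('a, 'b) monoid_scheme \<Rightarrow> 'a set \<Rightarrow> bool" where
  "int_independent G S \<longleftrightarrow>
     (\<forall>c::'a \<Rightarrow> int. (\<Otimes>\<^bsub>G\<^esub>s\<in>S. s [^]\<^bsub>G\<^esub> c s) = \<one>\<^bsub>G\<^esub> \<longrightarrow> (\<forall>s\<in>S. c s = 0))"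

definition abelian_rank :: "('a, 'b) monoid_scheme \<Rightarrow> enat" where
  "abelian_rank G =
     (SUP S \<in> {S. finite S \<and> S \<subseteq> carrier G \<and> int_independent G S}. enat (card S))"

end

theory Submission
  imports Defs
begin

text \<open>
  A discrete abelian group of isometries of hyperbolic space of dimension \<open>k + 1\<close> can have rank \<open>k\<close>: take
  translations of a horosphere. The smaller bound reflects that \<open>\<Gamma>\<close> is approximated by cyclic groups,
  and it comes from counting dimensions in the algebra generated by one matrix.

  Put \<open>N = k + 2\<close>, and let \<open>\<tau>\<close> be the adjoint with respect to the Lorentz form, so that \<open>\<tau> A\<close> is the inverse
  of \<open>A\<close> for \<open>A\<close> in the Lorentz group. The algebra generated by such an \<open>A\<close> has dimension at most \<open>N\<close>
  (\<open>power_in_span_powers\<close>) and splits into symmetric and skew elements for \<open>\<tau>\<close>. Every difference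
  \<open>A\<^sup>n - A\<^sup>-\<^sup>n\<close> is a multiple of \<open>A - A\<^sup>-\<^sup>1\<close> by a symmetric element, so these differences span a space
  of dimension at most \<open>d = N div 2 = k div 2 + 1\<close> (\<open>cyclic_skew_family_related\<close>). Linear relations
  with bounded coefficients survive limits, so the same bound holds for the span of the differences
  \<open>x - \<tau> x\<close> with \<open>x \<in> \<Gamma>\<close> (\<open>limit_of_cyclic_groups_related\<close>).

  This span is the space of skew elements of the commutative algebra spanned by \<open>\<Gamma>\<close>, and it plays the
  part of a Lie algebra. Each element of \<open>\<Gamma>\<close> has a positive power without negative real eigenvalues
  (\<open>power_without_negative_eigenvalues\<close>), and such a power is the exponential of a skew element of the
  algebra (\<open>skew_logarithm\<close>). Given more than \<open>d\<close> elements of \<open>\<Gamma>\<close>, the logarithms of suitable powers are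
  linearly related over the reals. Dirichlet's simultaneous approximation theorem turns the relation
  into nonzero integral combinations of the logarithms that are arbitrarily small
  (\<open>small_integer_combination\<close>). Their exponentials are products of powers of the given elements, they
  lie in \<open>\<Gamma>\<close> and come arbitrarily close to the identity, so discreteness forces one of them to be the
  identity. The given elements are therefore not independent over the integers.
\<close>

section \<open>The Banach algebra of real square matrices\<close>

text \<open>
  The exponential series lives in unital Banach algebras. On \<open>real ^ 'm ^ 'm\<close> the product \<open>*\<close> is
  componentwise and the norm gives the identity norm \<open>sqrt CARD('m)\<close>, so matrices are copied into
  a type whose product is the matrix product and whose norm is the operator norm.
\<close>

typedef ('m::finite) sqmat = "UNIV :: (real^'m^'m) set"
  morphisms entries sqmat ..

setup_lifting type_definition_sqmat

instantiation sqmat :: (finite) real_algebra_1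
begin

lift_definition zero_sqmat :: "'a sqmat" is 0 .
lift_definition one_sqmat :: "'a sqmat" is "mat 1" .
lift_definition plus_sqmat :: "'a sqmat \<Rightarrow> 'a sqmat \<Rightarrow> 'a sqmat" is "(+)" .
lift_definition minus_sqmat :: "'a sqmat \<Rightarrow> 'a sqmat \<Rightarrow> 'a sqmat" is "(-)" .
lift_definition uminus_sqmat :: "'a sqmat \<Rightarrow> 'a sqmat" is uminus .
lift_definition times_sqmat :: "'a sqmat \<Rightarrow> 'a sqmat \<Rightarrow> 'a sqmat" is "(**)" .
lift_definition scaleR_sqmat :: "real \<Rightarrow> 'a sqmat \<Rightarrow> 'a sqmat" is "scaleR" .

instance
proof
  fix a b c :: "'a sqmat" and r s :: real
  show "a + b + c = a + (b + c)" "a + b = b + a" "0 + a = a" "- a + a = 0" "a - b = a + - b"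
    by (transfer; simp)+
  show "r *\<^sub>R (a + b) = r *\<^sub>R a + r *\<^sub>R b" "(r + s) *\<^sub>R a = r *\<^sub>R a + s *\<^sub>R a"
    "r *\<^sub>R s *\<^sub>R a = (r * s) *\<^sub>R a" "1 *\<^sub>R a = a"
    by (transfer; simp add: algebra_simps)+
  show "a * b * c = a * (b * c)"
    by transfer (simp add: matrix_mul_assoc)
  show "(a + b) * c = a * c + b * c" "a * (b + c) = a * b + a * c"
    by (transfer; simp add: matrix_matrix_mult_def vec_eq_iff algebra_simps sum.distrib)+
  show "r *\<^sub>R a * b = r *\<^sub>R (a * b)" "a * r *\<^sub>R b = r *\<^sub>R (a * b)"
    by (transfer; simp add: matrix_matrix_mult_def vec_eq_iff sum_distrib_left mult.assoc mult.left_commute)+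
  show "1 * a = a" "a * 1 = a"
    by (transfer; simp)+
  show "(0::'a sqmat) \<noteq> 1"
    by transfer (auto simp: vec_eq_iff mat_def)
qed

end

instantiation sqmat :: (finite) real_normed_algebra_1
begin

lift_definition norm_sqmat :: "'a sqmat \<Rightarrow> real" is "\<lambda>A. onorm ((*v) A)" .
definition dist_sqmat :: "'a sqmat \<Rightarrow> 'a sqmat \<Rightarrow> real" where "dist_sqmat a b = norm (a - b)"
definition sgn_sqmat :: "'a sqmat \<Rightarrow> 'a sqmat" where "sgn_sqmat a = a /\<^sub>R norm a"
definition uniformity_sqmat :: "('a sqmat \<times> 'a sqmat) filter" where
  "uniformity_sqmat = (INF e\<in>{0<..}. principal {(x, y). dist x y < e})"
definition open_sqmat :: "'a sqmat set \<Rightarrow> bool" where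
  "open_sqmat U \<longleftrightarrow> (\<forall>x\<in>U. eventually (\<lambda>(x', y). x' = x \<longrightarrow> y \<in> U) uniformity)"

instance
proof
  fix a b :: "'a sqmat" and r :: real and U :: "'a sqmat set"
  have bl: "bounded_linear ((*v) A)" for A :: "real^'a^'a"
    by (rule matrix_vector_mul_bounded_linear)
  show "dist a b = norm (a - b)" by (simp add: dist_sqmat_def)
  show "sgn a = a /\<^sub>R norm a" by (simp add: sgn_sqmat_def)
  show "uniformity = (INF e\<in>{0<..}. principal {(x::'a sqmat, y). dist x y < e})"
    by (rule uniformity_sqmat_def)
  show "open U \<longleftrightarrow> (\<forall>x\<in>U. eventually (\<lambda>(x', y). x' = x \<longrightarrow> y \<in> U) uniformity)"
    by (rule open_sqmat_def)
  show "norm a = 0 \<longleftrightarrow> a = 0"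
  proof transfer
    fix a :: "real^'a^'a"
    have "(\<forall>v. a *v v = 0) \<longleftrightarrow> a = 0"
      by (metis matrix_eq matrix_vector_mult_0)
    then show "onorm ((*v) a) = 0 \<longleftrightarrow> a = 0"
      by (simp add: onorm_eq_0[OF bl])
  qed
  show "norm (a + b) \<le> norm a + norm b"
  proof transfer
    fix a b :: "real^'a^'a"
    have "(*v) (a + b) = (\<lambda>v. a *v v + b *v v)"
      by (simp add: fun_eq_iff matrix_vector_mult_add_rdistrib)
    then show "onorm ((*v) (a + b)) \<le> onorm ((*v) a) + onorm ((*v) b)"
      by (simp add: onorm_triangle[OF bl bl])
  qed
  show "norm (r *\<^sub>R a) = \<bar>r\<bar> * norm a"
  proof transfer
    fix r :: real and a :: "real^'a^'a"
    have "(*v) (r *\<^sub>R a) = (\<lambda>v. r *\<^sub>R (a *v v))"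
      by (simp add: fun_eq_iff scaleR_matrix_vector_assoc)
    then show "onorm ((*v) (r *\<^sub>R a)) = \<bar>r\<bar> * onorm ((*v) a)"
      by (simp add: onorm_scaleR[OF bl])
  qed
  show "norm (a * b) \<le> norm a * norm b"
    by transfer (use onorm_compose[OF bl bl] in \<open>simp add: o_def matrix_vector_mul_assoc\<close>)
  show "norm (1 :: 'a sqmat) = 1"
  proof transfer
    have "(*v) (mat 1) = (\<lambda>v::real^'a. v)"
      by (simp add: fun_eq_iff)
    then show "onorm ((*v) (mat 1 :: real^'a^'a)) = 1"
      by (simp only: onorm_id)
  qed
qed

end

lemma linear_entries: "linear entries"
  by (rule linearI; transfer; simp)

lemma linear_sqmat: "linear sqmat"
  by (rule linearI) (simp_all add: plus_sqmat.abs_eq scaleR_sqmat.abs_eq)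

lemma bounded_linear_sqmat: "bounded_linear sqmat"
  using linear_sqmat by (simp add: linear_conv_bounded_linear)

lemma bounded_linear_entries: "bounded_linear (entries :: 'm::finite sqmat \<Rightarrow> _)"
proof (rule bounded_linear_intro)
  fix A B :: "'m sqmat" and r :: real
  show "entries (A + B) = entries A + entries B" "entries (r *\<^sub>R A) = r *\<^sub>R entries A"
    by (transfer; simp)+
  have "norm (entries A) \<le> (\<Sum>i\<in>UNIV. \<Sum>j\<in>UNIV. \<bar>entries A $ i $ j\<bar>)"
  proof -
    have "norm (entries A) \<le> (\<Sum>i\<in>UNIV. norm (entries A $ i))"
      by (simp add: norm_vec_def[of "entries A"] L2_set_le_sum)
    also have "\<dots> \<le> (\<Sum>i\<in>UNIV. \<Sum>j\<in>UNIV. \<bar>entries A $ i $ j\<bar>)"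
      by (intro sum_mono norm_le_l1_cart)
    finally show ?thesis .
  qed
  also have "\<dots> \<le> (\<Sum>i\<in>(UNIV::'m set). \<Sum>j\<in>(UNIV::'m set). norm A)"
    by (intro sum_mono) (transfer, rule matrix_component_le_onorm)
  finally show "norm (entries A) \<le> norm A * (real CARD('m) * real CARD('m))"
    by (simp add: mult_ac)
qed

instance sqmat :: (finite) banach
proof
  fix X :: "nat \<Rightarrow> 'a sqmat"
  assume "Cauchy X"
  then have "Cauchy (\<lambda>n. entries (X n))"
    by (rule bounded_linear.Cauchy[OF bounded_linear_entries])
  then obtain L where "(\<lambda>n. entries (X n)) \<longlonglongrightarrow> L"
    by (auto simp: Cauchy_convergent_iff convergent_def)
  then have "(\<lambda>n. sqmat (entries (X n))) \<longlonglongrightarrow> sqmat L"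
    by (rule bounded_linear.tendsto[OF bounded_linear_sqmat])
  then show "convergent X"
    by (auto simp: entries_inverse convergent_def)
qed

section \<open>Logarithms by integration along a segment\<close>

text \<open>
  Riemann sums of \<open>f\<close> are linear combinations of its values, and the integral is a limit of them.
\<close>

lemma integral_in_closed_subspace:
  fixes f :: "real \<Rightarrow> 'a::banach"
  assumes S: "subspace S" "closed S" and f: "f integrable_on {a..b}"
    and mem: "\<And>t. t \<in> {a..b} \<Longrightarrow> f t \<in> S"
  shows "integral {a..b} f \<in> S"
proof -
  have "\<exists>y\<in>S. dist y (integral {a..b} f) < e" if "e > 0" for e
  proof -
    have "(f has_integral integral {a..b} f) (cbox a b)"
      using f by (simp add: integrable_integral)
    from this[unfolded has_integral, rule_format, OF \<open>e > 0\<close>]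
    obtain \<gamma> where "gauge \<gamma>" and \<gamma>: "\<forall>D. D tagged_division_of cbox a b \<and> \<gamma> fine D \<longrightarrow>
        norm ((\<Sum>(x, k)\<in>D. measure lborel k *\<^sub>R f x) - integral {a..b} f) < e"
      by (elim exE conjE)
    obtain D where D: "D tagged_division_of cbox a b" "\<gamma> fine D"
      using fine_division_exists[OF \<open>gauge \<gamma>\<close>] .
    have "(\<Sum>(x, k)\<in>D. measure lborel k *\<^sub>R f x) \<in> S"
    proof (rule subspace_sum[OF S(1)], clarify)
      fix x k assume "(x, k) \<in> D"
      then have "x \<in> {a..b}"
        using tagged_division_ofD(2,3)[OF D(1) \<open>(x, k) \<in> D\<close>] by auto
      then show "measure lborel k *\<^sub>R f x \<in> S"
        by (intro subspace_scale[OF S(1)] mem)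
    qed
    moreover have "dist (\<Sum>(x, k)\<in>D. measure lborel k *\<^sub>R f x) (integral {a..b} f) < e"
      using \<gamma> D by (simp only: dist_norm)
    ultimately show ?thesis
      by (rule bexI[rotated])
  qed
  then show ?thesis
    using closed_approachable[OF S(2), of "integral {a..b} f"] by simp
qed

text \<open>
  The terms of order at least two in the exponential series are bounded in norm by those of the real
  exponential at \<open>norm y\<close>, which leaves an error of at most \<open>(norm y)\<^sup>2\<close>.
\<close>

lemma exp_has_derivative_at_0:
  "(exp has_derivative (\<lambda>h. h)) (at (0::'a::{real_normed_algebra_1,banach}))"
proof -
  have bound: "norm (exp y - 1 - y) \<le> (norm y)\<^sup>2" if "norm y \<le> 1" for y :: 'a
  proof -
    have summable: "summable (\<lambda>n. inverse (fact (n + 2)) *\<^sub>R (norm y ^ (n + 2)))"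
      using summable_ignore_initial_segment[OF summable_exp_generic[of "norm y"], of 2] by simp
    have "norm (exp y - 1 - y) = norm (\<Sum>n. inverse (fact (n + 2)) *\<^sub>R (y ^ (n + 2)))"
      by (simp add: exp_first_two_terms)
    also have "\<dots> \<le> (\<Sum>n. inverse (fact (n + 2)) *\<^sub>R (norm y ^ (n + 2)))"
    proof (rule norm_suminf_le[OF _ summable])
      show "norm (inverse (fact (n + 2)) *\<^sub>R y ^ (n + 2)) \<le> inverse (fact (n + 2)) *\<^sub>R norm y ^ (n + 2)" for n
        using norm_power_ineq[of y "n + 2"] by (simp add: mult_left_mono)
    qed
    also have "\<dots> = exp (norm y) - 1 - norm y"
      by (simp add: exp_first_two_terms[of "norm y"])
    also have "\<dots> \<le> (norm y)\<^sup>2"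
      using exp_bound[of "norm y"] that by simp
    finally show ?thesis .
  qed
  show ?thesis
  proof (rule has_derivativeI_sandwich[where H="\<lambda>y. norm y" and e=1])
    show "norm (exp y - exp 0 - (y - 0)) / norm (y - 0) \<le> norm y"
      if "y \<in> UNIV" "y \<noteq> 0" "dist y 0 < 1" for y :: 'a
      using bound[of y] that by (simp add: divide_simps power2_eq_square)
    show "((\<lambda>y. norm y) \<longlongrightarrow> 0) (at (0::'a))"
      by (intro tendsto_norm_zero tendsto_ident_at)
  qed (simp_all add: bounded_linear_ident)
qed

text \<open>
  Commutation at \<open>t\<close> gives \<open>exp (X s) = exp (X t) * exp (X s - X t)\<close>, which reduces the
  derivative at \<open>X t\<close> to the one at \<open>0\<close>.
\<close>

lemma has_vector_derivative_exp_commuting: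
  fixes X :: "real \<Rightarrow> 'a::{real_normed_algebra_1,banach}"
  assumes "(X has_vector_derivative D) (at t within T)" "t \<in> T"
    and comm: "\<And>s. s \<in> T \<Longrightarrow> X s * X t = X t * X s"
  shows "((\<lambda>s. exp (X s)) has_vector_derivative exp (X t) * D) (at t within T)"
proof -
  have "((\<lambda>s. X s - X t) has_derivative (\<lambda>h. h *\<^sub>R D)) (at t within T)"
    using assms(1) unfolding has_vector_derivative_def
    by (auto intro!: derivative_eq_intros)
  moreover have "(exp has_derivative (\<lambda>h. h)) (at (X t - X t))"
    using exp_has_derivative_at_0 by simp
  ultimately have "((\<lambda>s. exp (X s - X t)) has_derivative (\<lambda>h. h *\<^sub>R D)) (at t within T)"
    by (rule has_derivative_compose)
  then have "((\<lambda>s. exp (X t) * exp (X s - X t)) has_vector_derivative exp (X t) * D) (at t within T)"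
    unfolding has_vector_derivative_def[symmetric]
    by (rule bounded_linear.has_vector_derivative[OF bounded_linear_mult_right])
  then show ?thesis
  proof (rule has_vector_derivative_transform[OF \<open>t \<in> T\<close>, rotated])
    show "exp (X s) = exp (X t) * exp (X s - X t)" if "s \<in> T" for s
      using exp_add_commuting[of "X t" "X s - X t"] comm[OF that] by (simp add: right_diff_distrib left_diff_distrib)
  qed
qed

text \<open>
  The resolvent identity \<open>R t - R s = (s - t) *\<^sub>R (R t * a * R s)\<close> bounds the increment in terms
  of \<open>norm (R t)\<close>; near \<open>s\<close> the same estimate shows that \<open>norm (R t) \<le> 2 * norm (R s)\<close>.
\<close>

lemma continuous_on_resolvent:
  fixes a :: "'a::real_normed_algebra_1" and R :: "real \<Rightarrow> 'a"
  assumes inv: "\<And>t. t \<in> T \<Longrightarrow> R t * (1 + t *\<^sub>R a) = 1" "\<And>t. t \<in> T \<Longrightarrow> (1 + t *\<^sub>R a) * R t = 1"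
  shows "continuous_on T R"
  unfolding continuous_on_def
proof
  fix s assume s: "s \<in> T"
  define c where "c t = \<bar>t - s\<bar> * (norm a * norm (R s))" for t
  have c0: "(c \<longlongrightarrow> 0) (at s within T)"
    unfolding c_def by (auto intro!: tendsto_eq_intros)
  have diff: "norm (R t - R s) \<le> norm (R t) * c t" if t: "t \<in> T" for t
  proof -
    have "R t - R s = R t * ((1 + s *\<^sub>R a) * R s) - (R t * (1 + t *\<^sub>R a)) * R s"
      using inv s t by simp
    also have "\<dots> = (s - t) *\<^sub>R (R t * (a * R s))"
      by (simp add: algebra_simps)
    finally have "norm (R t - R s) = \<bar>t - s\<bar> * norm (R t * (a * R s))"
      by (simp add: abs_minus_commute)
    also have "\<dots> \<le> \<bar>t - s\<bar> * (norm (R t) * (norm a * norm (R s)))"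
      by (meson mult_left_mono norm_ge_zero abs_ge_zero norm_mult_ineq order_trans)
    finally show ?thesis
      by (simp add: c_def mult_ac)
  qed
  have "\<forall>\<^sub>F t in at s within T. t \<in> T"
    by (simp add: eventually_at_filter)
  moreover have "\<forall>\<^sub>F t in at s within T. c t < 1/2"
    using order_tendstoD(2)[OF c0, of "1/2"] by simp
  ultimately have "\<forall>\<^sub>F t in at s within T. norm (R t - R s) \<le> 2 * norm (R s) * c t"
  proof eventually_elim
    case (elim t)
    have "c t \<ge> 0" by (simp add: c_def)
    have "norm (R t) \<le> norm (R s) + norm (R t - R s)"
      by (metis add.commute diff_add_cancel norm_triangle_ineq)
    also have "\<dots> \<le> norm (R s) + norm (R t) * (1/2)"
      using diff[OF elim(1)] elim(2) mult_left_mono[of "c t" "1/2" "norm (R t)"] by simp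
    finally have "norm (R t) \<le> 2 * norm (R s)" by simp
    then show ?case
      using diff[OF elim(1)] \<open>c t \<ge> 0\<close> mult_right_mono order_trans by blast
  qed
  moreover have "((\<lambda>t. 2 * norm (R s) * c t) \<longlongrightarrow> 0) (at s within T)"
    using tendsto_mult_right_zero[OF c0] by simp
  ultimately have "((\<lambda>t. R t - R s) \<longlongrightarrow> 0) (at s within T)"
    by (rule Lim_null_comparison)
  then show "(R \<longlongrightarrow> R s) (at s within T)"
    by (simp add: LIM_zero_iff)
qed

text \<open>
  The integral is the logarithm of \<open>1 + a\<close> obtained by integrating the logarithmic derivative
  along the segment from \<open>1\<close> to \<open>1 + a\<close>: with \<open>X\<close> its primitive, the derivative of
  \<open>exp (- X s) * (1 + s *\<^sub>R a)\<close> vanishes. The commutative subspace \<open>E\<close> contains the values of \<open>X\<close>,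
  which is what the derivative of \<open>exp\<close> along a curve requires. Unlike a power series at \<open>1\<close>, this
  works as soon as the segment consists of units.
\<close>

lemma exp_integral_resolvent:
  fixes a :: "'a::{real_normed_algebra_1,banach}" and R :: "real \<Rightarrow> 'a"
  assumes inv: "\<And>t. t \<in> {0..1} \<Longrightarrow> R t * (1 + t *\<^sub>R a) = 1" "\<And>t. t \<in> {0..1} \<Longrightarrow> (1 + t *\<^sub>R a) * R t = 1"
    and E: "subspace E" "closed E" and comm: "\<And>x y. x \<in> E \<Longrightarrow> y \<in> E \<Longrightarrow> x * y = y * x"
    and mem: "\<And>t. t \<in> {0..1} \<Longrightarrow> a * R t \<in> E"
  shows "exp (integral {0..1} (\<lambda>t. a * R t)) = 1 + a"
proof -
  define X where "X u = integral {0..u} (\<lambda>t. a * R t)" for u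
  have cont: "continuous_on {0..1} (\<lambda>t. a * R t)"
    by (intro continuous_intros continuous_on_resolvent[of _ _ a] inv)
  have XE: "- X u \<in> E" if "u \<in> {0..1}" for u
    unfolding X_def using that mem continuous_on_subset[OF cont, of "{0..u}"]
    by (intro subspace_neg[OF E(1)] integral_in_closed_subspace E integrable_continuous_real) auto
  have "((\<lambda>s. exp (- X s) * (1 + s *\<^sub>R a)) has_vector_derivative 0) (at t within {0..1})"
    if t: "t \<in> {0..1}" for t
  proof -
    have "((\<lambda>s. - X s) has_vector_derivative - (a * R t)) (at t within {0..1})"
      unfolding X_def by (intro has_vector_derivative_minus integral_has_vector_derivative cont t)
    then have "((\<lambda>s. exp (- X s)) has_vector_derivative exp (- X t) * - (a * R t)) (at t within {0..1})"
      using t by (rule has_vector_derivative_exp_commuting) (intro comm XE t)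
    moreover have "((\<lambda>s. 1 + s *\<^sub>R a) has_vector_derivative a) (at t within {0..1})"
      by (auto intro!: derivative_eq_intros)
    ultimately have "((\<lambda>s. exp (- X s) * (1 + s *\<^sub>R a)) has_vector_derivative
        exp (- X t) * a + exp (- X t) * - (a * R t) * (1 + t *\<^sub>R a)) (at t within {0..1})"
      by (rule has_vector_derivative_mult)
    also have "exp (- X t) * a + exp (- X t) * - (a * R t) * (1 + t *\<^sub>R a) =
        exp (- X t) * (a - a * (R t * (1 + t *\<^sub>R a)))"
      by (simp add: algebra_simps)
    finally show ?thesis
      using inv(1)[OF t] by simp
  qed
  then obtain c where c: "\<And>s. s \<in> {0..1} \<Longrightarrow> exp (- X s) * (1 + s *\<^sub>R a) = c"
    by (rule has_vector_derivative_zero_constant[OF convex_real_interval(5)]) blast+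
  have "exp (- X 1) * (1 + a) = 1"
    using c[of 1] c[of 0] by (simp add: X_def)
  then have "exp (X 1) * exp (- X 1) * (1 + a) = exp (X 1)"
    by (simp only: mult.assoc mult_1_right)
  then show ?thesis
    by (simp only: exp_minus_inverse mult_1_left X_def)
qed

lemma integral_unit_interval_reflect:
  fixes f :: "real \<Rightarrow> 'a::banach"
  assumes "f integrable_on {0..1}"
  shows "integral {0..1} (\<lambda>t. f (1 - t)) = integral {0..1} f"
proof -
  have "(f has_integral integral {0..1} f) (cbox 0 1)"
    using assms by (simp add: integrable_integral)
  from has_integral_affinity[OF this, of "-1" 1]
  have "((\<lambda>t. f (1 - t)) has_integral integral {0..1} f) ((\<lambda>t. 1 - t) ` {0..1})"
    by (simp del: image_diff_atLeastAtMost)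
  also have "(\<lambda>t::real. 1 - t) ` {0..1} = {0..1}"
    by simp
  finally show ?thesis
    by (rule integral_unique)
qed

section \<open>Linear relations in finite families\<close>

text \<open>
  Linear dependence of a family rather than of a set: repeated members count as a relation, so that
  the notion passes to limits, in which distinct vectors may become equal.
\<close>

definition linearly_related :: "'i set \<Rightarrow> ('i \<Rightarrow> 'a::real_vector) \<Rightarrow> bool" where
  "linearly_related I w \<longleftrightarrow> (\<exists>t. (\<exists>i\<in>I. t i \<noteq> 0) \<and> (\<Sum>i\<in>I. t i *\<^sub>R w i) = 0)"

lemma linearly_related_if_in_span:
  assumes B: "finite B" "card B < card I" and w: "\<And>i. i \<in> I \<Longrightarrow> w i \<in> span B"
  shows "linearly_related I w"
proof -
  have "finite I"
    using B(2) card.infinite by fastforce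
  show ?thesis
  proof (cases "inj_on w I")
    case True
    have "dependent (w ` I)"
    proof (rule ccontr)
      assume "\<not> dependent (w ` I)"
      then have "card (w ` I) \<le> card B"
        using independent_span_bound[OF B(1)] w by blast
      then show False
        using B(2) True by (simp add: card_image)
    qed
    then obtain u where "\<exists>v\<in>w ` I. u v \<noteq> 0" "(\<Sum>v\<in>w ` I. u v *\<^sub>R v) = 0"
      using \<open>finite I\<close> by (auto simp: dependent_finite)
    then have "(\<exists>i\<in>I. u (w i) \<noteq> 0) \<and> (\<Sum>i\<in>I. u (w i) *\<^sub>R w i) = 0"
      using True by (simp add: sum.reindex)
    then show ?thesis
      unfolding linearly_related_def by (rule exI[where x="\<lambda>i. u (w i)"])
  next
    case False
    then obtain i j where ij: "i \<in> I" "j \<in> I" "i \<noteq> j" "w i = w j"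
      by (auto simp: inj_on_def)
    define t :: "'b \<Rightarrow> real" where "t k = of_bool (k = i) - of_bool (k = j)" for k
    have "(\<Sum>k\<in>I. t k *\<^sub>R w k) = (\<Sum>k\<in>I. if k = i then w k else 0) - (\<Sum>k\<in>I. if k = j then w k else 0)"
      unfolding t_def sum_subtractf[symmetric] by (intro sum.cong) auto
    also have "\<dots> = 0"
      using ij \<open>finite I\<close> by simp
    finally show ?thesis
      unfolding linearly_related_def using ij by (intro exI[of _ t]) (auto simp: t_def intro!: bexI[of _ i])
  qed
qed

text \<open>
  Coefficient vectors of \<open>l\<^sup>1\<close>-norm one have a convergent subsequence, whose limit again has norm one
  and is therefore a nontrivial relation.
\<close>

lemma linearly_related_limit:
  fixes w :: "'i \<Rightarrow> 'a::real_normed_vector"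
  assumes I: "finite I" and rel: "\<And>n. linearly_related I (W n)"
    and lim: "\<And>i. i \<in> I \<Longrightarrow> (\<lambda>n. W n i) \<longlonglongrightarrow> w i"
  shows "linearly_related I w"
proof -
  have "\<exists>t. (\<Sum>i\<in>I. \<bar>t i\<bar>) = 1 \<and> (\<Sum>i\<in>I. t i *\<^sub>R W n i) = 0" for n
  proof -
    obtain t j where t: "j \<in> I" "t j \<noteq> 0" "(\<Sum>i\<in>I. t i *\<^sub>R W n i) = 0"
      using rel[of n] unfolding linearly_related_def by blast
    define c where "c = (\<Sum>i\<in>I. \<bar>t i\<bar>)"
    have "c > 0"
      unfolding c_def using t I by (intro sum_pos2[of I j]) auto
    have "(\<Sum>i\<in>I. \<bar>t i / c\<bar>) = 1"
      using \<open>c > 0\<close> by (simp flip: sum_divide_distrib c_def)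
    moreover have "(\<Sum>i\<in>I. (t i / c) *\<^sub>R W n i) = (1 / c) *\<^sub>R (\<Sum>i\<in>I. t i *\<^sub>R W n i)"
      by (simp add: scaleR_sum_right)
    ultimately show ?thesis
      using t(3) by (intro exI[of _ "\<lambda>i. t i / c"]) simp
  qed
  then obtain t where t: "\<And>n. (\<Sum>i\<in>I. \<bar>t n i\<bar>) = 1" "\<And>n. (\<Sum>i\<in>I. t n i *\<^sub>R W n i) = 0"
    by metis
  have "\<bar>t n i\<bar> \<le> 1" if "i \<in> I" for n i
    using member_le_sum[OF that, of "\<lambda>i. \<bar>t n i\<bar>"] I t(1)[of n] by simp
  then have "\<And>i. i \<in> I \<Longrightarrow> bounded ((\<lambda>f. f i) ` range t)"
    by (auto simp: bounded_iff)
  from compact_lemma_general[where proj="\<lambda>f i. f i" and unproj="\<lambda>f. f", OF I this]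
  obtain l :: "'i \<Rightarrow> real" and r :: "nat \<Rightarrow> nat" where r: "strict_mono r"
    and l: "\<And>e. e > 0 \<Longrightarrow> \<forall>\<^sub>F n in sequentially. \<forall>i\<in>I. dist (t (r n) i) (l i) < e"
    by blast
  have tl: "(\<lambda>n. t (r n) i) \<longlonglongrightarrow> l i" if "i \<in> I" for i
  proof (rule tendstoI)
    fix e :: real assume "e > 0"
    from l[OF this] show "\<forall>\<^sub>F n in sequentially. dist (t (r n) i) (l i) < e"
      by (rule eventually_mono) (use that in blast)
  qed
  have Wl: "(\<lambda>n. W (r n) i) \<longlonglongrightarrow> w i" if "i \<in> I" for i
    using LIMSEQ_subseq_LIMSEQ[OF lim[OF that] r] by (simp add: o_def)
  have "(\<lambda>n. \<Sum>i\<in>I. \<bar>t (r n) i\<bar>) \<longlonglongrightarrow> (\<Sum>i\<in>I. \<bar>l i\<bar>)"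
    by (intro tendsto_intros tl)
  then have "(\<Sum>i\<in>I. \<bar>l i\<bar>) = 1"
    using t(1) by (simp add: LIMSEQ_const_iff)
  then have "\<exists>i\<in>I. l i \<noteq> 0"
    by (metis abs_zero sum.neutral zero_neq_one)
  moreover have "(\<lambda>n. \<Sum>i\<in>I. t (r n) i *\<^sub>R W (r n) i) \<longlonglongrightarrow> (\<Sum>i\<in>I. l i *\<^sub>R w i)"
    by (intro tendsto_intros tl Wl)
  then have "(\<Sum>i\<in>I. l i *\<^sub>R w i) = 0"
    using t(2) by (simp add: LIMSEQ_const_iff)
  ultimately show ?thesis
    unfolding linearly_related_def by blast
qed

lemma finite_basis_if_generators_related:
  fixes G :: "'a::real_vector set"
  assumes "\<And>F. F \<subseteq> G \<Longrightarrow> card F = Suc d \<Longrightarrow> linearly_related F (\<lambda>x. x)"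
  obtains B where "finite B" "card B \<le> d" "span B = span G"
proof -
  obtain B where B: "B \<subseteq> G" "independent B" "G \<subseteq> span B"
    using maximal_independent_subset .
  have "finite B \<and> card B \<le> d"
  proof (rule ccontr)
    assume neg: "\<not> (finite B \<and> card B \<le> d)"
    obtain F where F: "F \<subseteq> B" "card F = Suc d"
    proof (cases "finite B")
      case True
      with neg have "Suc d \<le> card B" by simp
      then show thesis
        using obtain_subset_with_card_n that by metis
    next
      case False
      then show thesis
        using infinite_arbitrarily_large[of B "Suc d"] that by auto
    qed
    then have "linearly_related F (\<lambda>x. x)"
      using assms B(1) by blast
    moreover have "finite F"
      using F(2) by (intro card_ge_0_finite) simp
    ultimately have "dependent F"
      by (auto simp: linearly_related_def dependent_finite)
    with B(2) F(1) show False
      using dependent_mono by blast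
  qed
  moreover have "span B = span G"
    using B by (metis span_eq span_superset subset_trans)
  ultimately show thesis
    using that by blast
qed

text \<open>
  Scale a real relation so that one coefficient \<open>t j\<close> is \<open>1\<close>. Dirichlet's simultaneous
  approximation gives \<open>q > 0\<close> and integers \<open>c i\<close> close to \<open>q * t i\<close>; subtracting \<open>q\<close> times the relation
  shows that the integral combination is small, and \<open>c j\<close>, being within distance less than one
  of \<open>q\<close>, is not zero.
\<close>

lemma small_integer_combination:
  fixes X :: "'i \<Rightarrow> 'a::real_normed_vector"
  assumes "finite I" "linearly_related I X" "e > 0"
  obtains c :: "'i \<Rightarrow> int" where "\<exists>i\<in>I. c i \<noteq> 0" "norm (\<Sum>i\<in>I. of_int (c i) *\<^sub>R X i) < e"
proof -
  obtain t' j where t': "j \<in> I" "t' j \<noteq> 0" "(\<Sum>i\<in>I. t' i *\<^sub>R X i) = 0"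
    using assms(2) unfolding linearly_related_def by blast
  define t where "t i = t' i / t' j" for i
  have "(\<Sum>i\<in>I. t i *\<^sub>R X i) = (1 / t' j) *\<^sub>R (\<Sum>i\<in>I. t' i *\<^sub>R X i)"
    by (simp add: scaleR_sum_right t_def)
  then have t: "t j = 1" "(\<Sum>i\<in>I. t i *\<^sub>R X i) = 0"
    using t' by (simp_all add: t_def)
  define K where "K = (\<Sum>i\<in>I. norm (X i))"
  have "K \<ge> 0" by (simp add: K_def sum_nonneg)
  obtain M :: nat where M: "K / e < real M"
    using reals_Archimedean2 by blast
  then have "M > 0"
    using \<open>K \<ge> 0\<close> \<open>e > 0\<close> by (metis divide_nonneg_pos gr0I not_less of_nat_0)
  obtain f where f: "bij_betw f {..<card I} I"
    using ex_bij_betw_nat_finite[OF assms(1)] by (metis atLeast0LessThan)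
  obtain q p where q: "0 < q" "q \<le> int (M ^ card I)"
    and p: "\<And>k. k < card I \<Longrightarrow> \<bar>of_int q * t (f k) - of_int (p k)\<bar> < 1 / real M"
    by (rule Dirichlet_approx_simult[OF \<open>M > 0\<close>, of "card I" "\<lambda>k. t (f k)"], rule that) auto
  define c where "c i = p (inv_into {..<card I} f i)" for i
  have c: "\<bar>of_int q * t i - of_int (c i)\<bar> < 1 / real M" if "i \<in> I" for i
    using p[of "inv_into {..<card I} f i"] that f unfolding c_def
    by (metis bij_betw_def bij_betw_inv_into_right inv_into_into lessThan_iff)
  have "\<bar>real_of_int q - real_of_int (c j)\<bar> < 1 / real M"
    using c[OF t'(1)] t(1) by simp
  also have "\<dots> \<le> 1"
    using \<open>M > 0\<close> by simp
  finally have "c j \<noteq> 0"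
    using q by linarith
  have "(\<Sum>i\<in>I. of_int (c i) *\<^sub>R X i) = (\<Sum>i\<in>I. of_int (c i) *\<^sub>R X i) - of_int q *\<^sub>R (\<Sum>i\<in>I. t i *\<^sub>R X i)"
    using t(2) by simp
  also have "\<dots> = (\<Sum>i\<in>I. (of_int (c i) - of_int q * t i) *\<^sub>R X i)"
    by (simp add: scaleR_sum_right scaleR_diff_left sum_subtractf)
  also have "norm \<dots> \<le> (\<Sum>i\<in>I. 1 / real M * norm (X i))"
  proof (rule sum_norm_le)
    fix i assume "i \<in> I"
    with c[of i] show "norm ((of_int (c i) - of_int q * t i) *\<^sub>R X i) \<le> 1 / real M * norm (X i)"
      unfolding norm_scaleR by (intro mult_right_mono) (simp_all add: abs_minus_commute)
  qed
  also have "\<dots> = K / real M"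
    by (simp add: K_def sum_divide_distrib)
  also have "\<dots> < e"
    using M \<open>e > 0\<close> \<open>M > 0\<close> by (simp add: divide_simps mult.commute)
  finally show thesis
    using \<open>c j \<noteq> 0\<close> t'(1) that by blast
qed

text \<open>
  Multiplication by \<open>p\<close> is injective because \<open>q\<close> undoes it, so it maps the finite-dimensional
  space \<open>span B\<close> onto itself. The typical use is \<open>x = 1\<close>: an inverse of an element of a
  finite-dimensional subalgebra lies in the subalgebra.
\<close>

lemma inverse_mult_in_subspace:
  fixes p q :: "'a::real_algebra_1"
  assumes B: "finite B" and p: "\<And>x. x \<in> span B \<Longrightarrow> p * x \<in> span B" and qp: "q * p = 1"
    and x: "x \<in> span B"
  shows "q * x \<in> span B"
proof -
  have lin: "linear ((*) p)"
    by (rule linearI) (simp_all add: distrib_left)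
  have cancel: "q * (p * y) = y" for y
    using qp by (simp flip: mult.assoc)
  have inj: "inj ((*) p)"
    by (rule inj_on_inverseI[where g="(*) q"]) (simp add: cancel)
  obtain C where C: "C \<subseteq> span B" "independent C" "span B \<subseteq> span C"
    using maximal_independent_subset .
  have "finite C"
    using independent_span_bound[OF B C(2,1)] by simp
  have CB: "span C = span B"
    using span_minimal[OF C(1) subspace_span] C(3) by blast
  have "x \<in> span ((*) p ` C)"
  proof (rule ccontr)
    assume x': "x \<notin> span ((*) p ` C)"
    have "independent ((*) p ` C)"
      by (intro linear_independent_injective_image[OF lin C(2)] inj_on_subset[OF inj]) simp
    with x' have ind: "independent (insert x ((*) p ` C))"
      by (simp add: independent_insert)
    have sub: "insert x ((*) p ` C) \<subseteq> span C"
    proof -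
      have "p * c \<in> span B" if "c \<in> C" for c
        using that C(1) by (intro p) blast
      then show ?thesis
        unfolding CB using x by blast
    qed
    have "card (insert x ((*) p ` C)) \<le> card C"
      using independent_span_bound[OF \<open>finite C\<close> ind sub] by (rule conjunct2)
    moreover have "x \<notin> (*) p ` C"
      using contra_subsetD[OF span_superset x'] .
    moreover have "card ((*) p ` C) = card C"
      by (intro card_image inj_on_subset[OF inj]) simp
    ultimately show False
      using \<open>finite C\<close> by simp
  qed
  then have "x \<in> (*) p ` span B"
    using linear_span_image[OF lin, of C] by (metis CB)
  then obtain y where "y \<in> span B" "x = p * y"
    by (elim imageE)
  then show ?thesis
    by (simp only: cancel)
qed

lemma closed_subspace_sqmat:
  fixes E :: "'m::finite sqmat set"
  assumes "subspace E"
  shows "closed E"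
proof -
  have "closed (entries ` E)"
    by (intro closed_subspace linear_subspace_image[OF linear_entries assms])
  then have "closed (entries -` (entries ` E))"
    by (intro continuous_closed_vimage linear_continuous_at bounded_linear_entries)
  also have "entries -` (entries ` E) = E"
    by (auto simp: entries_inject)
  finally show ?thesis .
qed

lemma finite_basis_sqmat:
  fixes E :: "'m::finite sqmat set"
  assumes "subspace E"
  obtains B where "finite B" "span B = E"
proof -
  obtain C where C: "C \<subseteq> entries ` E" "independent C" "entries ` E \<subseteq> span C"
    using maximal_independent_subset .
  have "span C = entries ` E"
    using span_minimal[OF C(1) linear_subspace_image[OF linear_entries assms]] C(3) by blast
  then have "span (sqmat ` C) = sqmat ` entries ` E"
    by (simp add: linear_span_image[OF linear_sqmat])
  also have "\<dots> = E"
    by (simp add: image_image entries_inverse)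
  finally show thesis
    using that independent_imp_finite[OF C(2)] by blast
qed

section \<open>Powers of a matrix\<close>

definition act :: "'m::finite sqmat \<Rightarrow> real^'m \<Rightarrow> real^'m" where
  "act A v = entries A *v v"

lemma act_simps [simp]:
  "act 0 v = 0" "act 1 v = v" "act A 0 = 0" "act (- A) v = - act A v"
  "act (A + B) v = act A v + act B v" "act (A - B) v = act A v - act B v"
  "act (r *\<^sub>R A) v = r *\<^sub>R act A v" "act A (r *\<^sub>R v) = r *\<^sub>R act A v"
  "act (A * B) v = act A (act B v)"
  "act A (v + w) = act A v + act A w" "act A (v - w) = act A v - act A w" "act A (- v) = - act A v"
proof -
  show "act 0 v = 0" "act 1 v = v" "act A 0 = 0"
    by (simp_all add: act_def zero_sqmat.rep_eq one_sqmat.rep_eq)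
  show minus: "act (- A) v = - act A v"
    by (simp add: act_def uminus_sqmat.rep_eq vec_eq_iff matrix_vector_mult_def sum_negf)
  show plus: "act (A + B) v = act A v + act B v" for B
    by (simp add: act_def plus_sqmat.rep_eq matrix_vector_mult_add_rdistrib)
  show "act (A - B) v = act A v - act B v"
    by (simp add: act_def minus_sqmat.rep_eq matrix_vector_mult_diff_rdistrib)
  show "act (r *\<^sub>R A) v = r *\<^sub>R act A v"
    by (simp add: act_def scaleR_sqmat.rep_eq scaleR_matrix_vector_assoc)
  show "act A (r *\<^sub>R v) = r *\<^sub>R act A v" "act A (v + w) = act A v + act A w"
    "act A (v - w) = act A v - act A w"
    by (simp_all add: act_def matrix_vector_mult_scaleR matrix_vector_right_distrib matrix_vector_mult_diff_distrib)
  show "act (A * B) v = act A (act B v)"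
    by (simp add: act_def times_sqmat.rep_eq matrix_vector_mul_assoc)
  show "act A (- v) = - act A v"
    by (simp add: act_def vec_eq_iff matrix_vector_mult_def sum_negf)
qed

lemma linear_act: "linear (act A)" "linear (\<lambda>A. act A v)"
  by (simp_all add: linearI)

lemma act_eq_0_iff: "(\<forall>v. act A v = 0) \<longleftrightarrow> A = 0"
proof
  assume "\<forall>v. act A v = 0"
  then have "entries A = entries 0"
    by (auto simp: matrix_eq act_def zero_sqmat.rep_eq)
  then show "A = 0"
    by (simp add: entries_inject)
qed simp

text \<open>
  The values at \<open>A\<close> of the monic polynomials of degree \<open>m\<close>.
\<close>

definition monic_in :: "'a::real_algebra_1 \<Rightarrow> nat \<Rightarrow> 'a set" where
  "monic_in A m = {A ^ m + x | x. x \<in> span ((^) A ` {..<m})}"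

lemma mult_in_span:
  fixes S :: "'a::real_algebra_1 set"
  assumes "\<And>s t. s \<in> S \<Longrightarrow> t \<in> T \<Longrightarrow> s * t \<in> span U"
    and "x \<in> span S" "y \<in> span T"
  shows "x * y \<in> span U"
proof -
  have *: "s * y \<in> span U" if "s \<in> S" for s
    using \<open>y \<in> span T\<close>
    by (induction rule: span_induct_alt) (auto simp: distrib_left intro!: span_add span_scale span_zero assms(1)[OF that])
  show ?thesis
    using \<open>x \<in> span S\<close>
    by (induction rule: span_induct_alt) (auto simp: distrib_right intro!: span_add span_scale span_zero *)
qed

lemma monic_in_mult:
  assumes "p \<in> monic_in A m" "q \<in> monic_in A n"
  shows "p * q \<in> monic_in A (m + n)"
proof -
  obtain x where x: "p = A ^ m + x" "x \<in> span ((^) A ` {..<m})"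
    using assms(1) by (auto simp: monic_in_def)
  obtain y where y: "q = A ^ n + y" "y \<in> span ((^) A ` {..<n})"
    using assms(2) by (auto simp: monic_in_def)
  have "A ^ m * y \<in> span ((^) A ` {..<m + n})"
    by (rule mult_in_span[OF _ _ y(2), of "{A ^ m}"]) (auto simp: span_base simp flip: power_add)
  moreover have "q \<in> span ((^) A ` {..n})"
    unfolding y(1)
  proof (rule span_add)
    show "y \<in> span ((^) A ` {..n})"
      using y(2) by (rule set_mp[OF span_mono, rotated]) auto
  qed (simp add: span_base)
  then have "x * q \<in> span ((^) A ` {..<m + n})"
    by (rule mult_in_span[OF _ x(2), rotated]) (auto intro!: span_base simp flip: power_add)
  moreover have "p * q = A ^ (m + n) + (A ^ m * y + x * q)"
    by (simp add: x(1) y(1) algebra_simps power_add)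
  ultimately show ?thesis
    unfolding monic_in_def using span_add by blast
qed

lemma monic_in_commute:
  assumes "p \<in> monic_in A m"
  shows "A * p = p * A"
proof -
  obtain x where x: "p = A ^ m + x" "x \<in> span ((^) A ` {..<m})"
    using assms by (auto simp: monic_in_def)
  from x(2) have "A * x = x * A"
    by (induction rule: span_induct_alt) (auto simp: algebra_simps power_commutes)
  then show ?thesis
    by (simp add: x(1) algebra_simps power_commutes)
qed

lemma independent_if_successively_new:
  assumes "\<And>i. i < m \<Longrightarrow> v i \<notin> span (v ` {..<i})"
  shows "independent (v ` {..<m}) \<and> card (v ` {..<m}) = m"
  using assms
proof (induction m)
  case (Suc m)
  then have IH: "independent (v ` {..<m})" "card (v ` {..<m}) = m" and new: "v m \<notin> span (v ` {..<m})"
    by auto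
  moreover have "v m \<notin> v ` {..<m}"
    using contra_subsetD[OF span_superset new] .
  ultimately show ?case
    by (simp add: lessThan_Suc independent_insert)
qed (simp add: independent_empty)

text \<open>
  Extend \<open>C\<close> to a basis of \<open>W\<close>: the image is spanned by the images of the new basis vectors.
\<close>

lemma dim_image_kernel_le:
  fixes f :: "'a::euclidean_space \<Rightarrow> 'b::euclidean_space"
  assumes f: "linear f" and C: "independent C" "C \<subseteq> W" "\<And>c. c \<in> C \<Longrightarrow> f c = 0"
  shows "dim (f ` W) + card C \<le> dim W"
proof -
  obtain D where D: "C \<subseteq> D" "D \<subseteq> W" "independent D" "W \<subseteq> span D"
    using maximal_independent_subset_extend[OF C(2,1)] .
  have fin: "finite D"
    using D(3) by (rule independent_imp_finite)
  have "f ` W \<subseteq> f ` span D"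
    using D(4) by blast
  also have "\<dots> = span (f ` D)"
    by (simp add: linear_span_image[OF f])
  also have "\<dots> \<subseteq> span (f ` (D - C))"
  proof (rule span_minimal[OF _ subspace_span], clarify)
    fix d assume "d \<in> D"
    then show "f d \<in> span (f ` (D - C))"
      by (cases "d \<in> C") (auto simp: C(3) span_zero span_base)
  qed
  finally have "dim (f ` W) \<le> card (f ` (D - C))"
    using fin by (intro dim_le_card) auto
  also have "\<dots> \<le> card (D - C)"
    using fin by (intro card_image_le) auto
  also have "\<dots> = card D - card C"
    using fin D(1) by (simp add: card_Diff_subset finite_subset)
  also have "card D = dim W"
    using D by (intro basis_card_eq_dim)
  finally show ?thesis
    using card_mono[OF fin D(1)] \<open>card D = dim W\<close> by linarith
qed

text \<open>
  Take \<open>w \<noteq> 0\<close> in \<open>W\<close> and the least \<open>m\<close> for which \<open>A\<^sup>m w\<close> depends linearly on the earlier iterates.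
  This gives a monic \<open>q\<close> of degree \<open>m\<close> that kills the \<open>m\<close>-dimensional cyclic space of \<open>w\<close>, so
  \<open>q W\<close> is an invariant subspace whose dimension is smaller by at least \<open>m\<close>. An annihilator of
  \<open>q W\<close> times \<open>q\<close> annihilates \<open>W\<close>.
\<close>

lemma monic_annihilator:
  fixes A :: "'m::finite sqmat"
  assumes "subspace W" "\<And>w. w \<in> W \<Longrightarrow> act A w \<in> W"
  shows "\<exists>m\<le>dim W. \<exists>p\<in>monic_in A m. \<forall>w\<in>W. act p w = 0"
  using assms
proof (induction "dim W" arbitrary: W rule: less_induct)
  case (less W)
  show ?case
  proof (cases "W \<subseteq> {0}")
    case True
    have "1 \<in> monic_in A 0"
      by (simp add: monic_in_def)
    moreover have "\<forall>w\<in>W. act 1 w = 0"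
      using True by auto
    ultimately show ?thesis
      by blast
  next
    case False
    then obtain w where w: "w \<in> W" "w \<noteq> 0"
      by blast
    define v where "v i = act (A ^ i) w" for i
    define m where "m = (LEAST m. v m \<in> span (v ` {..<m}))"
    have "\<exists>m. v m \<in> span (v ` {..<m})"
    proof (rule ccontr)
      assume "\<not> ?thesis"
      then have "independent (v ` {..<Suc CARD('m)}) \<and> card (v ` {..<Suc CARD('m)}) = Suc CARD('m)"
        by (intro independent_if_successively_new) blast
      then show False
        using independent_bound[of "v ` {..<Suc CARD('m)}"] by simp
    qed
    then have vm: "v m \<in> span (v ` {..<m})"
      unfolding m_def by (rule LeastI_ex)
    have "v i \<notin> span (v ` {..<i})" if "i < m" for i
      using that unfolding m_def by (rule not_less_Least)
    then have indep: "independent (v ` {..<m})" and card: "card (v ` {..<m}) = m"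
      using independent_if_successively_new[of m v] by auto
    have "m > 0"
    proof (rule ccontr)
      assume "\<not> m > 0"
      then show False
        using vm w(2) by (simp add: v_def)
    qed
    have "v ` {..<m} = (\<lambda>x. act x w) ` (^) A ` {..<m}"
      by (auto simp: v_def)
    then have "v m \<in> (\<lambda>x. act x w) ` span ((^) A ` {..<m})"
      using vm linear_span_image[OF linear_act(2), of w "(^) A ` {..<m}"] by simp
    then obtain x where x: "x \<in> span ((^) A ` {..<m})" "act x w = v m"
      by auto
    define q where "q = A ^ m - x"
    have q: "q \<in> monic_in A m"
      using span_neg[OF x(1)] by (auto simp: monic_in_def q_def intro!: exI[of _ "- x"])
    note comm = monic_in_commute[OF q]
    have qw: "act q w = 0"
      by (simp add: q_def x(2) v_def)
    have qv: "act q (v i) = 0" for i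
    proof -
      have "act q (v i) = act (q * A ^ i) w"
        by (simp add: v_def)
      also have "q * A ^ i = A ^ i * q"
        using comm by (intro power_commuting_commutes[symmetric]) simp
      finally show ?thesis
        by (simp add: qw)
    qed
    have vW: "v i \<in> W" for i
      unfolding v_def by (induction i) (auto simp: w less.prems(2))
    have "dim (act q ` W) + card (v ` {..<m}) \<le> dim W"
      by (intro dim_image_kernel_le linear_act indep) (auto simp: qv vW)
    then have dim: "dim (act q ` W) + m \<le> dim W"
      by (simp only: card)
    have sub: "subspace (act q ` W)"
      by (intro linear_subspace_image linear_act less.prems)
    have inv: "act A u \<in> act q ` W" if u: "u \<in> act q ` W" for u
    proof -
      obtain u' where u': "u' \<in> W" "u = act q u'"
        using u by (elim imageE)
      have "act A u = act (A * q) u'"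
        by (simp add: u')
      also have "\<dots> = act q (act A u')"
        by (simp add: comm)
      finally show ?thesis
        using less.prems(2)[OF u'(1)] by (rule image_eqI)
    qed
    have "dim (act q ` W) < dim W"
      using dim \<open>m > 0\<close> by linarith
    from less.hyps[OF this sub inv] obtain m' p where p: "m' \<le> dim (act q ` W)" "p \<in> monic_in A m'"
        "\<forall>u\<in>act q ` W. act p u = 0"
      by auto
    have "m' + m \<le> dim W"
      using dim p(1) by linarith
    moreover have "\<forall>u\<in>W. act (p * q) u = 0"
      using p(3) by simp
    ultimately show ?thesis
      using monic_in_mult[OF p(2) q] by (intro exI[of _ "m' + m"] conjI bexI[of _ "p * q"])
  qed
qed

text \<open>
  The dimension bound that the Cayley-Hamilton theorem gives for the algebra generated by \<open>A\<close>,
  here from an annihilating monic polynomial of degree at most \<open>CARD('m)\<close>.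
\<close>

lemma power_in_span_powers:
  fixes A :: "'m::finite sqmat"
  shows "A ^ i \<in> span ((^) A ` {..<CARD('m)})"
proof -
  obtain m p where m: "m \<le> CARD('m)" and p: "p \<in> monic_in A m" "\<forall>w. act p w = 0"
    using monic_annihilator[of UNIV A] by auto
  from p obtain x where x: "x \<in> span ((^) A ` {..<m})" "A ^ m + x = 0"
    by (auto simp: monic_in_def act_eq_0_iff)
  then have Am: "A ^ m \<in> span ((^) A ` {..<m})"
    using span_neg[OF x(1)] by (simp add: eq_neg_iff_add_eq_0[symmetric])
  have "A ^ i \<in> span ((^) A ` {..<m})"
  proof (induction i rule: less_induct)
    case (less i)
    show ?case
    proof (cases "i < m")
      case False
      have "A ^ (i - m) * A ^ m \<in> span ((^) A ` {..<m})"
      proof (rule mult_in_span[OF _ _ Am, of "{A ^ (i - m)}"])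
        fix s t assume "s \<in> {A ^ (i - m)}" "t \<in> (^) A ` {..<m}"
        then obtain j where "j < m" "s * t = A ^ (i - m + j)"
          by (auto simp: power_add)
        with less[of "i - m + j"] False show "s * t \<in> span ((^) A ` {..<m})"
          by simp
      qed (simp add: span_base)
      with False show ?thesis
        by (simp flip: power_add)
    qed (simp add: span_base)
  qed
  then show ?thesis
    by (rule set_mp[OF span_mono, rotated]) (use m in auto)
qed

section \<open>Skew elements of the algebra generated by one matrix\<close>

lemma power_diff_commuting:
  fixes A B :: "'a::ring_1"
  assumes "A * B = B * A"
  shows "(A - B) * (\<Sum>i<n. A ^ i * B ^ (n - Suc i)) = A ^ n - B ^ n"
proof (induction n)
  case (Suc n)
  have "(\<Sum>i<Suc n. A ^ i * B ^ (Suc n - Suc i)) = (\<Sum>i<n. A ^ i * B ^ (n - Suc i)) * B + A ^ n"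
  proof -
    have "A ^ i * B ^ (n - i) = A ^ i * B ^ (n - Suc i) * B" if "i < n" for i
    proof -
      have "n - i = Suc (n - Suc i)"
        using that by simp
      then show ?thesis
        by (simp only: power_Suc2 mult.assoc)
    qed
    then show ?thesis
      by (simp add: sum_distrib_right)
  qed
  then have "(A - B) * (\<Sum>i<Suc n. A ^ i * B ^ (Suc n - Suc i)) =
      (A - B) * (\<Sum>i<n. A ^ i * B ^ (n - Suc i)) * B + (A - B) * A ^ n"
    by (simp only: distrib_left mult.assoc)
  also have "\<dots> = A ^ n * B - B ^ n * B + (A * A ^ n - B * A ^ n)"
    unfolding Suc.IH by (simp only: left_diff_distrib)
  also have "A ^ n * B = B * A ^ n"
    using assms by (rule power_commuting_commutes)
  finally show ?case
    by (simp add: power_commutes)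
qed simp

text \<open>
  The source of the factor one half in the rank bound. Let \<open>P\<close> be the algebra generated by \<open>A\<close>,
  of dimension at most \<open>CARD('m)\<close>. The involution \<open>\<tau>\<close> exchanges \<open>A\<close> with its inverse \<open>B\<close> and splits \<open>P\<close>
  into symmetric and skew elements. Each \<open>w = A\<^sup>n - B\<^sup>n\<close> is \<open>A - B\<close> times the symmetric element
  \<open>\<Sum>i<n. A ^ i * B ^ (n - Suc i)\<close>. Every skew \<open>w i\<close> thus comes with a symmetric partner \<open>z i\<close>, and
  when the \<open>2 * card I\<close> elements obtained in this way exceed the dimension of \<open>P\<close>, they satisfy a
  relation. Its skew and symmetric parts vanish separately, and multiplying the symmetric part by
  \<open>A - B\<close> turns it into another relation among the \<open>w i\<close>.
\<close>

lemma cyclic_skew_family_related: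
  fixes A B :: "'m::finite sqmat" and \<tau> :: "'m sqmat \<Rightarrow> 'm sqmat"
  assumes AB: "A * B = 1" "B * A = 1"
    and \<tau>: "linear \<tau>" "\<And>x y. \<tau> (x * y) = \<tau> y * \<tau> x" "\<tau> A = B" "\<tau> B = A"
    and card: "CARD('m) < 2 * card I"
    and g: "\<And>i. i \<in> I \<Longrightarrow> \<exists>n. g i = A ^ n \<or> g i = B ^ n"
  shows "linearly_related I (\<lambda>i. g i - \<tau> (g i))"
proof -
  define P where "P = span ((^) A ` {..<CARD('m)})"
  have pow: "A ^ n \<in> P" for n
    unfolding P_def by (rule power_in_span_powers)
  have P_mult: "x * y \<in> P" if "x \<in> P" "y \<in> P" for x y
    using that unfolding P_def
    by (rule mult_in_span[rotated]) (auto simp flip: power_add intro: power_in_span_powers)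
  have "B * 1 \<in> P"
    unfolding P_def
    by (rule inverse_mult_in_subspace[where p=A])
      (use P_mult[unfolded P_def] pow[unfolded P_def, of 1] pow[unfolded P_def, of 0] AB in auto)
  then have powB: "B ^ n \<in> P" for n
    using pow[of 0] by (induction n) (auto intro: P_mult)
  have \<tau>1: "\<tau> 1 = 1"
    using \<tau>(2)[of A B] AB(1) by (simp add: \<tau>(3,4))
  have \<tau>pow: "\<tau> (x ^ n) = \<tau> x ^ n" for x n
    by (induction n) (simp_all add: \<tau>1 \<tau>(2) power_commutes)
  define y where "y n = (\<Sum>i<n. A ^ i * B ^ (n - Suc i))" for n
  have yP: "y n \<in> P" for n
    unfolding y_def P_def by (intro span_sum P_mult[unfolded P_def] pow[unfolded P_def] powB[unfolded P_def])
  have y: "(A - B) * y n = A ^ n - B ^ n" for n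
    unfolding y_def by (rule power_diff_commuting) (simp add: AB)
  have \<tau>y: "\<tau> (y n) = y n" for n
  proof -
    have "\<tau> (y n) = (\<Sum>i<n. A ^ (n - Suc i) * B ^ i)"
      by (simp add: y_def linear_sum[OF \<tau>(1)] \<tau> \<tau>pow)
    also have "\<dots> = (\<Sum>i<n. A ^ (n - Suc i) * B ^ (n - Suc (n - Suc i)))"
      by (intro sum.cong) auto
    also have "\<dots> = y n"
      unfolding y_def by (rule sum.nat_diff_reindex)
    finally show ?thesis .
  qed
  define w where "w i = g i - \<tau> (g i)" for i
  have "\<exists>z\<in>P. \<tau> z = z \<and> w i \<in> P \<and> \<tau> (w i) = - w i \<and> (A - B) * z = w i" if i: "i \<in> I" for i
  proof -
    obtain n where "g i = A ^ n \<or> g i = B ^ n"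
      using g[OF i] by blast
    then consider "w i = A ^ n - B ^ n" | "w i = - (A ^ n - B ^ n)"
      by (auto simp: w_def \<tau>pow \<tau>)
    then show ?thesis
    proof cases
      case 1
      then show ?thesis
        using y[of n] \<tau>y[of n] yP[of n] pow[of n] powB[of n] unfolding P_def
        by (intro bexI[of _ "y n"]) (auto simp: linear_diff[OF \<tau>(1)] \<tau>pow \<tau> span_diff)
    next
      case 2
      then show ?thesis
        using y[of n] \<tau>y[of n] yP[of n] pow[of n] powB[of n] unfolding P_def
        by (intro bexI[of _ "- y n"])
          (auto simp: linear_diff[OF \<tau>(1)] linear_neg[OF \<tau>(1)] \<tau>pow \<tau> span_diff span_neg)
    qed
  qed
  then obtain z where z: "\<And>i. i \<in> I \<Longrightarrow> z i \<in> P" "\<And>i. i \<in> I \<Longrightarrow> \<tau> (z i) = z i"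
      "\<And>i. i \<in> I \<Longrightarrow> (A - B) * z i = w i"
    and w: "\<And>i. i \<in> I \<Longrightarrow> w i \<in> P" "\<And>i. i \<in> I \<Longrightarrow> \<tau> (w i) = - w i"
    by metis
  have fin: "finite I"
    using card card.infinite by fastforce
  have "linearly_related (I <+> I) (case_sum w z)"
  proof (rule linearly_related_if_in_span[of "(^) A ` {..<CARD('m)}"])
    have "card ((^) A ` {..<CARD('m)}) \<le> CARD('m)"
      using card_image_le[of "{..<CARD('m)}" "(^) A"] by simp
    also note card
    also have "2 * card I = card (I <+> I)"
      using fin by (simp add: card_Plus)
    finally show "card ((^) A ` {..<CARD('m)}) < card (I <+> I)" .
    show "case_sum w z j \<in> span ((^) A ` {..<CARD('m)})" if "j \<in> I <+> I" for j
      using that w(1) z(1) by (auto simp: P_def)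
  qed simp
  then obtain t where t: "\<exists>j\<in>I <+> I. t j \<noteq> 0" "(\<Sum>j\<in>I <+> I. t j *\<^sub>R case_sum w z j) = 0"
    unfolding linearly_related_def by blast
  define skew where "skew = (\<Sum>i\<in>I. t (Inl i) *\<^sub>R w i)"
  define sym where "sym = (\<Sum>i\<in>I. t (Inr i) *\<^sub>R z i)"
  have sum0: "skew + sym = 0"
    using t(2) fin by (simp add: sum.Plus skew_def sym_def)
  have "\<tau> skew = - skew" "\<tau> sym = sym"
    by (simp_all add: skew_def sym_def linear_sum[OF \<tau>(1)] linear_scale[OF \<tau>(1)] w(2) z(2) sum_negf)
  moreover have "\<tau> (skew + sym) = 0"
    by (simp add: sum0 linear_0[OF \<tau>(1)])
  ultimately have "skew = sym"
    by (simp add: linear_add[OF \<tau>(1)])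
  with sum0 have "2 *\<^sub>R sym = 0"
    by (simp add: scaleR_2)
  then have "skew = 0" "sym = 0"
    using \<open>skew = sym\<close> by auto
  have "(\<Sum>i\<in>I. t (Inr i) *\<^sub>R w i) = (A - B) * sym"
    unfolding sym_def sum_distrib_left by (intro sum.cong) (simp_all add: z(3))
  then have "(\<Sum>i\<in>I. t (Inr i) *\<^sub>R w i) = 0" "(\<Sum>i\<in>I. t (Inl i) *\<^sub>R w i) = 0"
    using \<open>skew = 0\<close> \<open>sym = 0\<close> by (simp_all add: skew_def)
  moreover obtain i where "i \<in> I" "t (Inl i) \<noteq> 0 \<or> t (Inr i) \<noteq> 0"
    using t(1) by auto
  ultimately show ?thesis
    unfolding linearly_related_def w_def by auto
qed

section \<open>Logarithms of elements inverted by an involution\<close>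

text \<open>
  Eigenvectors for \<open>c\<close> are independent of eigenvectors for other eigenvalues: applying \<open>T - d\<close>,
  with \<open>d\<close> the eigenvalue of \<open>u\<close>, removes the component along \<open>u\<close> and multiplies \<open>x\<close> by \<open>c - d\<close>.
\<close>

lemma eigenvector_in_span_of_eigenvectors:
  assumes "finite S" and T: "linear T"
    and S: "\<And>u. u \<in> S \<Longrightarrow> \<exists>d. d \<noteq> c \<and> T u = d *\<^sub>R u"
    and x: "x \<in> span S" "T x = c *\<^sub>R x"
  shows "x = 0"
  using assms(1) S x
proof (induction S arbitrary: x rule: finite_induct)
  case empty
  then show ?case by simp
next
  case (insert u S)
  obtain d where d: "d \<noteq> c" "T u = d *\<^sub>R u"
    using insert.prems(1) by blast
  obtain a where a: "x - a *\<^sub>R u \<in> span S"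
    using insert.prems(2) by (auto simp: span_insert)
  define y where "y = (c - d) *\<^sub>R x"
  have stable: "T s \<in> span S" if "s \<in> span S" for s
    using that
  proof (induction rule: span_induct_alt)
    case base
    then show ?case by (simp add: linear_0[OF T] span_zero)
  next
    case (step r v s)
    obtain b where "T v = b *\<^sub>R v"
      using insert.prems(1) step(1) by blast
    with step show ?case
      by (simp add: linear_add[OF T] linear_scale[OF T] span_add span_scale span_base)
  qed
  have "y = T x - d *\<^sub>R x"
    by (simp add: y_def insert.prems(3) scaleR_left_diff_distrib)
  also have "\<dots> = T (x - a *\<^sub>R u) - d *\<^sub>R (x - a *\<^sub>R u)"
    by (simp add: linear_diff[OF T] linear_scale[OF T] d(2) algebra_simps)
  finally have "y \<in> span S"
    using stable[OF a] a by (simp add: span_diff span_scale)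
  moreover have "T y = c *\<^sub>R y"
    by (simp add: y_def linear_scale[OF T] insert.prems(3))
  ultimately have "y = 0"
    using insert.IH insert.prems(1) by blast
  then show ?case
    using d(1) by (simp add: y_def)
qed

text \<open>
  If \<open>A\<close> raised to \<open>2 ^ j\<close> has a negative eigenvalue with eigenvector \<open>v j\<close>, then \<open>v j\<close> has a positive
  eigenvalue for every later power in the sequence. If this happened for all \<open>j\<close>, each \<open>v j\<close> would
  be independent of its predecessors, against finite dimension.
\<close>

lemma power_without_negative_eigenvalues:
  fixes A :: "'m::finite sqmat"
  obtains p :: nat where "p > 0" "\<And>c v. c < 0 \<Longrightarrow> act (A ^ p) v = c *\<^sub>R v \<Longrightarrow> v = 0"
proof -
  have "\<exists>j. \<forall>c v. c < 0 \<longrightarrow> act (A ^ (2 ^ j)) v = c *\<^sub>R v \<longrightarrow> v = 0"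
  proof (rule ccontr)
    assume "\<not> ?thesis"
    then have "\<forall>j. \<exists>c v. c < 0 \<and> act (A ^ (2 ^ j)) v = c *\<^sub>R v \<and> v \<noteq> 0"
      by blast
    then obtain c v where cv: "\<And>j. c j < (0::real)" "\<And>j. act (A ^ (2 ^ j)) (v j) = c j *\<^sub>R v j" "\<And>j. v j \<noteq> 0"
      by metis
    have pos: "\<exists>d>0. act (A ^ (2 ^ j)) (v i) = d *\<^sub>R v i" if "i < j" for i j
    proof -
      have "\<exists>d>0. act (A ^ (2 ^ (Suc i + k))) (v i) = d *\<^sub>R v i" for k
      proof (induction k)
        case 0
        have "act (A ^ (2 ^ Suc i)) (v i) = (c i * c i) *\<^sub>R v i"
          by (simp add: power_add mult_2 cv(2))
        then show ?case
          using cv(1)[of i] by (intro exI[of _ "c i * c i"]) (simp add: mult_neg_neg)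
      next
        case (Suc k)
        then obtain d where d: "d > 0" "act (A ^ (2 ^ (Suc i + k))) (v i) = d *\<^sub>R v i"
          by blast
        have "A ^ (2 ^ (Suc i + Suc k)) = A ^ (2 ^ (Suc i + k)) * A ^ (2 ^ (Suc i + k))"
          by (simp flip: power_add)
        then have "act (A ^ (2 ^ (Suc i + Suc k))) (v i) = (d * d) *\<^sub>R v i"
          by (simp only: act_simps d(2) scaleR_scaleR)
        then show ?case
          using d(1) by (intro exI[of _ "d * d"]) simp
      qed
      from this[of "j - Suc i"] that show ?thesis
        by simp
    qed
    have "v j \<notin> span (v ` {..<j})" for j
    proof
      assume "v j \<in> span (v ` {..<j})"
      moreover have "\<exists>d. d \<noteq> c j \<and> act (A ^ (2 ^ j)) u = d *\<^sub>R u" if "u \<in> v ` {..<j}" for u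
        using that pos[of _ j] cv(1)[of j] by force
      ultimately have "v j = 0"
        by (intro eigenvector_in_span_of_eigenvectors[OF _ linear_act(1), of _ "c j" "A ^ (2 ^ j)"])
          (auto simp: cv(2))
      with cv(3) show False
        by blast
    qed
    then have "independent (v ` {..<Suc CARD('m)}) \<and> card (v ` {..<Suc CARD('m)}) = Suc CARD('m)"
      by (intro independent_if_successively_new)
    then show False
      using independent_bound[of "v ` {..<Suc CARD('m)}"] by simp
  qed
  then obtain j where "\<forall>c v. c < 0 \<longrightarrow> act (A ^ (2 ^ j)) v = c *\<^sub>R v \<longrightarrow> v = 0"
    by blast
  then show thesis
    by (intro that[of "2 ^ j"]) auto
qed

lemma left_inverse_if_act_injective:
  fixes A :: "'m::finite sqmat"
  assumes "\<And>v. act A v = 0 \<Longrightarrow> v = 0"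
  obtains B where "B * A = 1"
proof -
  have "inj ((*v) (entries A))"
    using assms linear_injective_0[OF linear_act(1)[of A]] by (simp add: act_def[abs_def])
  then obtain B where "B ** entries A = mat 1"
    by (auto simp: matrix_left_invertible_injective[symmetric])
  then have "sqmat B * sqmat (entries A) = sqmat (mat 1)"
    by (simp add: times_sqmat.abs_eq)
  then show thesis
    using that[of "sqmat B"] by (simp add: entries_inverse one_sqmat_def)
qed

text \<open>
  Without negative eigenvalues, the segment from \<open>1\<close> to \<open>g\<close> consists of units, so integration along
  it gives a logarithm \<open>X\<close>. The involution carries the segment to the one from \<open>1\<close> to the inverse \<open>h\<close>
  of \<open>g\<close>, which is \<open>h\<close> times the original segment run backwards; hence \<open>\<tau> X = - X\<close>.
\<close>

lemma skew_logarithm: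
  fixes g h :: "'m::finite sqmat" and \<tau> :: "'m sqmat \<Rightarrow> 'm sqmat"
  assumes E: "subspace E" "1 \<in> E" "\<And>x y. x \<in> E \<Longrightarrow> y \<in> E \<Longrightarrow> x * y \<in> E"
    and comm: "\<And>x y. x \<in> E \<Longrightarrow> y \<in> E \<Longrightarrow> x * y = y * x"
    and gh: "g \<in> E" "h \<in> E" "h * g = 1"
    and \<tau>: "bounded_linear \<tau>" "\<And>x y. \<tau> (x * y) = \<tau> y * \<tau> x" "\<tau> 1 = 1" "\<tau> g = h"
    and neg: "\<And>c v. c < 0 \<Longrightarrow> act g v = c *\<^sub>R v \<Longrightarrow> v = 0"
  obtains X where "X \<in> E" "\<tau> X = - X" "exp X = g"
proof -
  define a where "a = g - 1"
  define P where "P t = 1 + t *\<^sub>R a" for t :: real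
  have aE: "a \<in> E"
    unfolding a_def by (intro subspace_diff E gh)
  have PE: "P t \<in> E" for t
    unfolding P_def by (intro subspace_add subspace_scale E aE)
  have gh': "g * h = 1"
    using comm[OF gh(1,2)] gh(3) by simp
  have "\<exists>r\<in>E. r * P t = 1" if t: "t \<in> {0..1}" for t
  proof -
    have "v = 0" if "act (P t) v = 0" for v
    proof (cases "t = 0 \<or> t = 1")
      case True
      then show ?thesis
      proof
        assume "t = 1"
        then have "act g v = 0"
          using that by (simp add: P_def a_def)
        then have "act (h * g) v = 0"
          by (simp only: act_simps)
        then show ?thesis
          by (simp only: gh(3) act_simps)
      qed (use that in \<open>simp add: P_def\<close>)
    next
      case False
      \<comment> \<open>A vector killed by \<open>P t\<close> would be an eigenvector of \<open>g\<close> with the negative eigenvalue \<open>(t - 1) / t\<close>.\<close>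
      have "t *\<^sub>R act g v = (t - 1) *\<^sub>R v"
        using that by (simp add: P_def a_def algebra_simps)
      then have "(1 / t) *\<^sub>R (t *\<^sub>R act g v) = (1 / t) *\<^sub>R ((t - 1) *\<^sub>R v)"
        by (simp only:)
      then have "act g v = ((t - 1) / t) *\<^sub>R v"
        using False by simp
      moreover have "(t - 1) / t < 0"
        using False t by (simp add: divide_neg_pos)
      ultimately show ?thesis
        by (intro neg)
    qed
    then obtain q where q: "q * P t = 1"
      using left_inverse_if_act_injective by metis
    obtain B where B: "finite B" "span B = E"
      using finite_basis_sqmat[OF E(1)] .
    have "q * 1 \<in> span B"
      by (rule inverse_mult_in_subspace[OF B(1) _ q]) (simp_all add: B(2) E(2,3) PE)
    with q show ?thesis
      by (auto simp: B(2))
  qed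
  then obtain R where RE: "\<And>t. t \<in> {0..1} \<Longrightarrow> R t \<in> E" and RP: "\<And>t. t \<in> {0..1} \<Longrightarrow> R t * P t = 1"
    by metis
  have PR: "P t * R t = 1" if "t \<in> {0..1}" for t
    using comm[OF PE RE[OF that], of t] RP[OF that] by simp
  define X where "X = integral {0..1} (\<lambda>t. a * R t)"
  have int: "(\<lambda>t. a * R t) integrable_on {0..1}"
    by (intro integrable_continuous_real continuous_intros continuous_on_resolvent[of _ _ a])
      (use RP PR in \<open>auto simp: P_def\<close>)
  have closed: "closed E"
    by (rule closed_subspace_sqmat[OF E(1)])
  have mem: "a * R t \<in> E" if "t \<in> {0..1}" for t
    using that by (intro E(3) aE RE)
  have "X \<in> E"
    unfolding X_def by (rule integral_in_closed_subspace[OF E(1) closed int mem])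
  moreover have "exp X = g"
  proof -
    have "exp X = 1 + a"
      unfolding X_def
      by (rule exp_integral_resolvent[OF _ _ E(1) closed comm mem]) (use RP PR in \<open>auto simp: P_def\<close>)
    then show ?thesis
      by (simp add: a_def)
  qed
  moreover have "\<tau> X = - X"
  proof -
    interpret \<tau>: bounded_linear \<tau> by fact
    have \<tau>f: "\<tau> (a * R t) = - (a * R (1 - t))" if t: "t \<in> {0..1}" for t
    proof -
      have t': "1 - t \<in> {0..1}"
        using t by simp
      have "\<tau> (P t) = h * P (1 - t)"
        by (simp add: P_def a_def \<tau>.add \<tau>.diff \<tau>.scaleR \<tau>(3,4) gh(3) algebra_simps)
      \<comment> \<open>As \<open>\<tau> (P t)\<close> is \<open>h * P (1 - t)\<close>, its inverse \<open>\<tau> (R t)\<close> is \<open>R (1 - t) * g\<close>.\<close>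
      moreover have "\<tau> (P t) * \<tau> (R t) = 1"
        using RP[OF t] by (simp flip: \<tau>(2) add: \<tau>(3))
      ultimately have "R (1 - t) * (g * (h * P (1 - t) * \<tau> (R t))) = R (1 - t) * g"
        by simp
      also have "g * (h * P (1 - t) * \<tau> (R t)) = P (1 - t) * \<tau> (R t)"
        using gh' by (simp flip: mult.assoc)
      also have "R (1 - t) * (P (1 - t) * \<tau> (R t)) = \<tau> (R t)"
        using RP[OF t'] by (simp flip: mult.assoc)
      finally have "\<tau> (a * R t) = R (1 - t) * g * (h - 1)"
        by (simp add: \<tau>(2) a_def \<tau>.diff \<tau>(3,4))
      also have "\<dots> = - (R (1 - t) * a)"
        by (simp add: a_def algebra_simps gh')
      also have "R (1 - t) * a = a * R (1 - t)"
        by (intro comm RE t' aE)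
      finally show ?thesis .
    qed
    have "\<tau> X = integral {0..1} (\<tau> \<circ> (\<lambda>t. a * R t))"
      unfolding X_def by (rule integral_linear[OF int \<tau>(1), symmetric])
    also have "\<dots> = integral {0..1} (\<lambda>t. - (a * R (1 - t)))"
      by (intro integral_cong) (simp add: \<tau>f)
    also have "\<dots> = - X"
      unfolding X_def using integral_unit_interval_reflect[OF int] by simp
    finally show ?thesis .
  qed
  ultimately show thesis
    using that by blast
qed

section \<open>The Lorentz group\<close>

lemma sqmat_mult: "sqmat (A ** B) = sqmat A * sqmat B"
  by (simp add: times_sqmat.abs_eq)

lemma sqmat_1: "sqmat (mat 1) = 1"
  by (simp add: one_sqmat_def)

lemma sqmat_eq_iff: "sqmat A = sqmat B \<longleftrightarrow> A = B"
  by (simp add: sqmat_inject)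

definition lorentz_matrix :: "real ^ ('n::finite option) ^ ('n option)" where
  "lorentz_matrix = (\<chi> i j. if i = j then if i = None then 1 else - 1 else 0)"

text \<open>
  The adjoint with respect to the bilinear form polarizing \<^const>\<open>lorentz_form\<close>.
\<close>

definition lorentz_adjoint :: "'n::finite option sqmat \<Rightarrow> 'n option sqmat" where
  "lorentz_adjoint A = sqmat (lorentz_matrix ** transpose (entries A) ** lorentz_matrix)"

lemma lorentz_matrix_vector: "(lorentz_matrix *v x) $ i = (if i = None then x $ i else - x $ i)"
  by (simp add: lorentz_matrix_def matrix_vector_mult_def if_distrib[of "\<lambda>a. a * _"] cong: if_cong)

lemma lorentz_matrix_square: "lorentz_matrix ** lorentz_matrix = mat 1"
  by (simp add: matrix_eq vec_eq_iff lorentz_matrix_vector flip: matrix_vector_mul_assoc)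

lemma transpose_lorentz_matrix: "transpose lorentz_matrix = lorentz_matrix"
  by (auto simp: lorentz_matrix_def transpose_def vec_eq_iff)

lemma lorentz_form_eq_inner: "lorentz_form x = x \<bullet> (lorentz_matrix *v x)"
proof -
  have "x \<bullet> (lorentz_matrix *v x) = (\<Sum>i\<in>insert None (range Some). x $ i * (lorentz_matrix *v x) $ i)"
    by (simp add: inner_vec_def UNIV_option_conv)
  also have "\<dots> = lorentz_form x"
    by (subst sum.insert)
      (auto simp: lorentz_form_def lorentz_matrix_vector sum.reindex sum_negf power2_eq_square)
  finally show ?thesis
    by simp
qed

lemma bounded_linear_lorentz_adjoint: "bounded_linear lorentz_adjoint"
proof -
  have "linear (\<lambda>A. lorentz_matrix ** transpose A ** lorentz_matrix :: real ^ ('a option) ^ ('a option))"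
    by (simp add: linear_iff matrix_matrix_mult_def transpose_def vec_eq_iff sum.distrib
        sum_distrib_left sum_distrib_right algebra_simps)
  then have "bounded_linear (\<lambda>A. lorentz_matrix ** transpose A ** lorentz_matrix :: real ^ ('a option) ^ ('a option))"
    by (simp add: linear_conv_bounded_linear)
  then show ?thesis
    unfolding lorentz_adjoint_def
    by (intro bounded_linear_compose[OF bounded_linear_sqmat]
        bounded_linear_compose[OF _ bounded_linear_entries])
qed

lemma lorentz_adjoint_eq:
  "lorentz_adjoint A = sqmat lorentz_matrix * sqmat (transpose (entries A)) * sqmat lorentz_matrix"
  by (simp add: lorentz_adjoint_def sqmat_mult)

lemma sqmat_lorentz_matrix_square: "sqmat lorentz_matrix * sqmat lorentz_matrix = 1"
  by (simp add: lorentz_matrix_square sqmat_1 flip: sqmat_mult)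

lemma sqmat_lorentz_matrix_cancel: "sqmat lorentz_matrix * (sqmat lorentz_matrix * A) = A"
  by (simp add: sqmat_lorentz_matrix_square flip: mult.assoc)

lemma lorentz_adjoint_mult: "lorentz_adjoint (A * B) = lorentz_adjoint B * lorentz_adjoint A"
  by (simp add: lorentz_adjoint_eq times_sqmat.rep_eq matrix_transpose_mul sqmat_mult mult.assoc
      sqmat_lorentz_matrix_cancel)

lemma lorentz_adjoint_involution: "lorentz_adjoint (lorentz_adjoint A) = A"
proof -
  have "transpose (entries (lorentz_adjoint A)) = lorentz_matrix ** (entries A ** lorentz_matrix)"
    by (simp add: lorentz_adjoint_def sqmat_inverse matrix_transpose_mul transpose_lorentz_matrix)
  then show ?thesis
    by (simp add: lorentz_adjoint_eq[of "lorentz_adjoint A"] sqmat_mult entries_inverse mult.assoc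
        sqmat_lorentz_matrix_cancel sqmat_lorentz_matrix_square)
qed

lemma lorentz_adjoint_1: "lorentz_adjoint 1 = 1"
  by (simp add: lorentz_adjoint_def one_sqmat.rep_eq transpose_mat lorentz_matrix_square sqmat_1)

text \<open>
  Preserving the quadratic form means preserving its polarization, that is \<open>A\<^sup>T J A = J\<close> for the Gram
  matrix \<open>J\<close>.
\<close>

lemma lorentz_adjoint_inverse:
  assumes "A \<in> SO_lorentz"
  shows "lorentz_adjoint (sqmat A) * sqmat A = 1" "sqmat A * lorentz_adjoint (sqmat A) = 1"
proof -
  define J :: "real ^ ('a option) ^ ('a option)" where "J = lorentz_matrix"
  have J_sym: "x \<bullet> (J *v y) = (J *v x) \<bullet> y" for x y
    unfolding J_def inner_vec_def by (intro sum.cong) (auto simp: lorentz_matrix_vector)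
  have form: "lorentz_form (A *v x) = lorentz_form x" for x
    using assms by (simp add: SO_lorentz_def)
  have polar: "lorentz_form (x + y) = lorentz_form x + lorentz_form y + 2 * (x \<bullet> (J *v y))" for x y
    unfolding lorentz_form_eq_inner J_def[symmetric]
    using J_sym[of y x] by (simp add: matrix_vector_right_distrib inner_add inner_commute)
  have "(A *v x) \<bullet> (J *v (A *v y)) = x \<bullet> (J *v y)" for x y
    using form[of "x + y"] by (simp add: matrix_vector_right_distrib polar form)
  then have "x \<bullet> ((transpose A ** J ** A) *v y) = x \<bullet> (J *v y)" for x y
    using dot_lmul_matrix[of x "transpose A" "J *v (A *v y)"]
    by (simp add: vector_transpose_matrix flip: matrix_vector_mul_assoc)
  then have "(transpose A ** J ** A) *v y = J *v y" for y
    by (intro vector_eq_ldot[THEN iffD1]) simp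
  then have "transpose A ** J ** A = J"
    by (simp add: matrix_eq)
  moreover have "(J ** transpose A ** J) ** A = J ** (transpose A ** J ** A)"
    by (simp only: matrix_mul_assoc)
  ultimately have "(J ** transpose A ** J) ** A = mat 1"
    by (simp add: J_def lorentz_matrix_square)
  moreover from this have "A ** (J ** transpose A ** J) = mat 1"
    by (simp only: matrix_left_right_inverse)
  ultimately show "lorentz_adjoint (sqmat A) * sqmat A = 1" "sqmat A * lorentz_adjoint (sqmat A) = 1"
    by (simp_all add: lorentz_adjoint_def J_def sqmat_inverse sqmat_1 flip: sqmat_mult)
qed

lemma SO_lorentz_mult:
  assumes "A \<in> SO_lorentz" "B \<in> SO_lorentz"
  shows "A ** B \<in> SO_lorentz"
  using assms by (simp add: SO_lorentz_def det_mul flip: matrix_vector_mul_assoc)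

lemma SO_lorentz_adjoint:
  assumes A: "A \<in> SO_lorentz"
  shows "entries (lorentz_adjoint (sqmat A)) \<in> SO_lorentz"
proof -
  define B where "B = entries (lorentz_adjoint (sqmat A))"
  have "sqmat (A ** B) = sqmat (mat 1)"
    using lorentz_adjoint_inverse(2)[OF A] by (simp add: B_def sqmat_mult sqmat_1 entries_inverse)
  then have AB: "A ** B = mat 1"
    by (simp only: sqmat_eq_iff)
  have "det A * det B = 1"
    using arg_cong[OF AB, of det] by (simp add: det_mul)
  then have "det B = 1"
    using A by (simp add: SO_lorentz_def)
  moreover have "lorentz_form (B *v x) = lorentz_form x" for x
  proof -
    have "lorentz_form (B *v x) = lorentz_form (A *v (B *v x))"
      using A by (simp add: SO_lorentz_def)
    then show ?thesis
      by (simp add: matrix_vector_mul_assoc AB)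
  qed
  ultimately show ?thesis
    by (simp add: SO_lorentz_def B_def)
qed

lemma carrier_SO0: "A \<in> carrier SO0 \<Longrightarrow> A \<in> SO_lorentz"
  using connected_component_subset by (auto simp: SO0_def)

text \<open>
  Translations and inversion are continuous self-maps of \<^const>\<open>SO_lorentz\<close>, so they permute its
  connected components.
\<close>

lemma group_SO0: "group (SO0 :: (real ^ ('n::finite option) ^ ('n option)) monoid)"
proof (rule groupI)
  let ?G = "SO0 :: (real ^ ('n option) ^ ('n option)) monoid"
  let ?S = "SO_lorentz :: (real ^ ('n option) ^ ('n option)) set"
  have 1: "mat 1 \<in> ?S"
    by (simp add: SO_lorentz_def)
  have transport: "connected_component ?S (f A) (f B)"
    if conn: "connected_component ?S A B" and f: "continuous_on ?S f" "f ` ?S \<subseteq> ?S" for f A B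
  proof -
    obtain T where T: "connected T" "T \<subseteq> ?S" "A \<in> T" "B \<in> T"
      using conn[unfolded connected_component_def] by (elim exE conjE)
    have "connected (f ` T)"
      by (rule connected_continuous_image[OF continuous_on_subset[OF f(1) T(2)] T(1)])
    then show ?thesis
      unfolding connected_component_def
    proof (intro exI conjI)
      show "f ` T \<subseteq> ?S"
        using T(2) f(2) by (rule order_trans[OF image_mono])
      show "connected (f ` T)"
        by fact
      show "f A \<in> f ` T"
        using T(3) by (rule imageI)
      show "f B \<in> f ` T"
        using T(4) by (rule imageI)
    qed
  qed
  show "\<one>\<^bsub>?G\<^esub> \<in> carrier ?G"
    using 1 by (simp add: SO0_def)
  fix A assume A: "A \<in> carrier ?G"
  then have A1: "connected_component ?S (mat 1) A"
    by (simp add: SO0_def)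
  have AS: "A \<in> ?S"
    using A by (rule carrier_SO0)
  show "\<one>\<^bsub>?G\<^esub> \<otimes>\<^bsub>?G\<^esub> A = A"
    by (simp add: SO0_def)
  show "\<exists>B\<in>carrier ?G. B \<otimes>\<^bsub>?G\<^esub> A = \<one>\<^bsub>?G\<^esub>"
  proof
    have cont: "continuous_on ?S (\<lambda>X. entries (lorentz_adjoint (sqmat X)))"
      by (intro linear_continuous_on bounded_linear_compose[OF bounded_linear_entries]
          bounded_linear_compose[OF bounded_linear_lorentz_adjoint bounded_linear_sqmat])
    have "(\<lambda>X. entries (lorentz_adjoint (sqmat X))) ` ?S \<subseteq> ?S"
      by (rule image_subsetI) (rule SO_lorentz_adjoint)
    with A1 cont have "connected_component ?S (entries (lorentz_adjoint (sqmat (mat 1)))) (entries (lorentz_adjoint (sqmat A)))"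
      by (rule transport[where f="\<lambda>X. entries (lorentz_adjoint (sqmat X))"])
    then show "entries (lorentz_adjoint (sqmat A)) \<in> carrier ?G"
      by (simp add: SO0_def sqmat_1 lorentz_adjoint_1 one_sqmat.rep_eq)
    have "sqmat (entries (lorentz_adjoint (sqmat A)) ** A) = sqmat (mat 1)"
      by (simp add: sqmat_mult entries_inverse lorentz_adjoint_inverse AS sqmat_1)
    then show "entries (lorentz_adjoint (sqmat A)) \<otimes>\<^bsub>?G\<^esub> A = \<one>\<^bsub>?G\<^esub>"
      by (simp add: SO0_def sqmat_eq_iff)
  qed
  fix B assume B: "B \<in> carrier ?G"
  have "continuous_on ?S (\<lambda>X. entries (sqmat A * sqmat X))"
    by (intro linear_continuous_on bounded_linear_compose[OF bounded_linear_entries]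
        bounded_linear_compose[OF bounded_linear_mult_right bounded_linear_sqmat])
  then have cont: "continuous_on ?S (\<lambda>X. A ** X)"
    by (simp add: sqmat_inverse flip: sqmat_mult)
  have "connected_component ?S (mat 1) B"
    using B by (simp add: SO0_def)
  moreover have "(\<lambda>X. A ** X) ` ?S \<subseteq> ?S"
    by (rule image_subsetI) (rule SO_lorentz_mult[OF AS])
  ultimately have "connected_component ?S (A ** mat 1) (A ** B)"
    using transport[of "mat 1" B "\<lambda>X. A ** X"] cont by (simp only:)
  then have "connected_component ?S A (A ** B)"
    by (simp only: matrix_mul_rid)
  with A1 have "connected_component ?S (mat 1) (A ** B)"
    by (rule connected_component_trans)
  then show "A \<otimes>\<^bsub>?G\<^esub> B \<in> carrier ?G"
    by (simp add: SO0_def)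
  fix C
  show "A \<otimes>\<^bsub>?G\<^esub> B \<otimes>\<^bsub>?G\<^esub> C = A \<otimes>\<^bsub>?G\<^esub> (B \<otimes>\<^bsub>?G\<^esub> C)"
    by (simp add: SO0_def matrix_mul_assoc)
qed

section \<open>Discrete limits of cyclic groups\<close>

text \<open>
  By assumption the skew elements of the form \<open>x - \<tau> x\<close> with \<open>x\<close> in \<open>G\<close> span a space of dimension at
  most \<open>d\<close>. Some positive power of each \<open>g i\<close> is the exponential of a skew element of \<open>span G\<close>, which
  lies in this space. More than \<open>d\<close> such logarithms satisfy a real relation, hence have nonzero
  integral combinations close to \<open>0\<close>, whose exponentials are close to \<open>1\<close>.
\<close>

lemma small_integer_relation_near_one:
  fixes G :: "'m::finite sqmat set" and \<tau> :: "'m sqmat \<Rightarrow> 'm sqmat" and g :: "'i \<Rightarrow> 'm sqmat"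
  assumes G: "1 \<in> G" "\<And>x y. x \<in> G \<Longrightarrow> y \<in> G \<Longrightarrow> x * y \<in> G" "\<And>x y. x \<in> G \<Longrightarrow> y \<in> G \<Longrightarrow> x * y = y * x"
    and \<tau>: "bounded_linear \<tau>" "\<And>x y. \<tau> (x * y) = \<tau> y * \<tau> x"
    and inv: "\<And>x. x \<in> G \<Longrightarrow> \<tau> x \<in> G" "\<And>x. x \<in> G \<Longrightarrow> \<tau> x * x = 1"
    and rel: "\<And>F. F \<subseteq> G \<Longrightarrow> card F = Suc d \<Longrightarrow> linearly_related F (\<lambda>x. x - \<tau> x)"
    and I: "finite I" "d < card I" and g: "\<And>i. i \<in> I \<Longrightarrow> g i \<in> G" and "e > 0"
  obtains X :: "'i \<Rightarrow> 'm sqmat" and p :: "'i \<Rightarrow> nat" and c :: "'i \<Rightarrow> int"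
  where "\<And>i. i \<in> I \<Longrightarrow> p i > 0" "\<And>i. i \<in> I \<Longrightarrow> exp (X i) = g i ^ p i"
    "\<And>i j. i \<in> I \<Longrightarrow> j \<in> I \<Longrightarrow> X i * X j = X j * X i"
    "\<exists>i\<in>I. c i \<noteq> 0" "norm (exp (\<Sum>i\<in>I. of_int (c i) *\<^sub>R X i) - 1) < e"
proof -
  define E where "E = span G"
  interpret \<tau>: bounded_linear \<tau> by fact
  have E: "subspace E" "1 \<in> E" "\<And>x y. x \<in> E \<Longrightarrow> y \<in> E \<Longrightarrow> x * y \<in> E"
    using G(1) by (auto simp: E_def span_base intro: mult_in_span[OF span_base[OF G(2)]])
  have comm: "x * y = y * x" if "x \<in> E" "y \<in> E" for x y
  proof -
    have *: "s * y = y * s" if "s \<in> G" for s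
      using \<open>y \<in> E\<close> unfolding E_def
      by (induction rule: span_induct_alt) (simp_all add: algebra_simps G(3)[OF that])
    show ?thesis
      using \<open>x \<in> E\<close> unfolding E_def
      by (induction rule: span_induct_alt) (simp_all add: algebra_simps *)
  qed
  have pow: "x ^ n \<in> G" if "x \<in> G" for x n
    using that by (induction n) (auto intro: G(1,2))
  have \<tau>1: "\<tau> 1 = 1"
    using inv(2)[OF G(1)] by simp
  have "\<exists>X p. p > 0 \<and> X \<in> E \<and> \<tau> X = - X \<and> exp X = g i ^ p" if i: "i \<in> I" for i
  proof -
    obtain p where p: "p > 0" "\<And>c v. c < 0 \<Longrightarrow> act (g i ^ p) v = c *\<^sub>R v \<Longrightarrow> v = 0"
      by (rule power_without_negative_eigenvalues[of "g i"]) blast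
    have x: "g i ^ p \<in> G"
      by (intro pow g i)
    obtain X where "X \<in> E" "\<tau> X = - X" "exp X = g i ^ p"
    proof (rule skew_logarithm[OF E comm _ _ inv(2)[OF x] \<tau> \<tau>1 refl p(2)])
      show "g i ^ p \<in> E" "\<tau> (g i ^ p) \<in> E"
        unfolding E_def by (intro span_base x inv(1))+
    qed auto
    with p(1) show ?thesis
      by blast
  qed
  then obtain X p where p: "\<And>i. i \<in> I \<Longrightarrow> p i > 0" and XE: "\<And>i. i \<in> I \<Longrightarrow> X i \<in> E"
    and skew: "\<And>i. i \<in> I \<Longrightarrow> \<tau> (X i) = - X i" and X: "\<And>i. i \<in> I \<Longrightarrow> exp (X i) = g i ^ p i"
    by metis
  define \<sigma> where "\<sigma> x = x - \<tau> x" for x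
  have \<sigma>: "linear \<sigma>"
    unfolding \<sigma>_def by (intro linear_compose_sub linear_ident \<tau>.linear)
  obtain B where B: "finite B" "card B \<le> d" "span B = span (\<sigma> ` G)"
  proof (rule finite_basis_if_generators_related)
    fix F assume F: "F \<subseteq> \<sigma> ` G" "card F = Suc d"
    then obtain H where H: "H \<subseteq> G" "inj_on \<sigma> H" "F = \<sigma> ` H"
      using subset_image_inj by metis
    then have "linearly_related H \<sigma>"
      using rel[of H] F(2) by (simp add: card_image \<sigma>_def[abs_def])
    then obtain t where t: "\<exists>h\<in>H. t h \<noteq> 0" "(\<Sum>h\<in>H. t h *\<^sub>R \<sigma> h) = 0"
      unfolding linearly_related_def by blast
    define u where "u = (\<lambda>f. t (inv_into H \<sigma> f))"
    have "(\<exists>f\<in>F. u f \<noteq> 0) \<and> (\<Sum>f\<in>F. u f *\<^sub>R f) = 0"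
      using t H(2) by (simp add: H(3) u_def sum.reindex)
    then show "linearly_related F (\<lambda>x. x)"
      unfolding linearly_related_def by (intro exI[of _ u])
  qed
  have "linearly_related I X"
  proof (rule linearly_related_if_in_span[OF B(1)])
    show "card B < card I"
      using B(2) I(2) by simp
    fix i assume i: "i \<in> I"
    \<comment> \<open>On skew elements \<open>\<sigma>\<close> is multiplication by two, and it maps \<open>span G\<close> onto \<open>span B\<close>.\<close>
    have "X i = \<sigma> ((1 / 2) *\<^sub>R X i)"
      by (simp add: \<sigma>_def \<tau>.scaleR skew[OF i] flip: scaleR_add_left)
    moreover have "(1 / 2) *\<^sub>R X i \<in> span G"
      using XE[OF i] by (simp add: E_def span_scale)
    ultimately have "X i \<in> \<sigma> ` span G"
      by (rule image_eqI)
    then show "X i \<in> span B"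
      using linear_span_image[OF \<sigma>, of G] B(3) by metis
  qed
  have "isCont exp (0 :: 'm sqmat)"
    by (rule has_derivative_continuous[OF exp_has_derivative_at_0])
  then obtain \<delta> where \<delta>: "\<delta> > 0" "\<And>Y :: 'm sqmat. norm Y < \<delta> \<Longrightarrow> norm (exp Y - 1) < e"
    using \<open>e > 0\<close> unfolding continuous_at_eps_delta by (auto simp: dist_norm)
  obtain c where c: "\<exists>i\<in>I. c i \<noteq> 0" "norm (\<Sum>i\<in>I. of_int (c i) *\<^sub>R X i) < \<delta>"
    using small_integer_combination[OF I(1) \<open>linearly_related I X\<close> \<delta>(1)] by metis
  show thesis
    by (rule that[OF p X _ c(1) \<delta>(2)[OF c(2)]]) (auto intro: comm XE)
qed

lemma exp_of_nat_scaleR: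
  fixes Y :: "'a::{real_normed_algebra_1,banach}"
  shows "exp (real n *\<^sub>R Y) = exp Y ^ n"
proof (induction n)
  case (Suc n)
  have "exp (real (Suc n) *\<^sub>R Y) = exp (Y + real n *\<^sub>R Y)"
    by (simp add: algebra_simps)
  also have "\<dots> = exp Y * exp (real n *\<^sub>R Y)"
    by (rule exp_add_commuting) simp
  finally show ?case
    by (simp add: Suc.IH)
qed simp

lemma right_inverse_exp:
  fixes Y :: "'a::{real_normed_algebra_1,banach}"
  assumes "x * exp Y = 1"
  shows "x = exp (- Y)"
proof -
  have "x * (exp Y * exp (- Y)) = exp (- Y)"
    using assms by (simp flip: mult.assoc)
  then show ?thesis
    by (simp add: exp_minus_inverse)
qed

text \<open>
  The relation holds in each cyclic group \<open>range (\<rho> n)\<close>, whose elements are powers of one matrix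
  and of its Lorentz adjoint, and it passes to the limit.
\<close>

lemma limit_of_cyclic_groups_related:
  fixes \<rho> :: "nat \<Rightarrow> int \<Rightarrow> real ^ ('n::finite option) ^ ('n option)"
  assumes hom: "\<And>n. \<rho> n \<in> hom integer_group SO0"
    and lim: "\<And>x. x \<in> F \<Longrightarrow> \<exists>s. (\<forall>n. s n \<in> range (\<rho> n)) \<and> s \<longlonglongrightarrow> entries x"
    and card: "CARD('n option) < 2 * card F"
  shows "linearly_related F (\<lambda>x. x - lorentz_adjoint x)"
proof -
  have fin: "finite F"
    using card card.infinite by fastforce
  obtain s where s: "\<And>x n. x \<in> F \<Longrightarrow> s x n \<in> range (\<rho> n)" "\<And>x. x \<in> F \<Longrightarrow> s x \<longlonglongrightarrow> entries x"
    using lim by metis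
  show ?thesis
  proof (rule linearly_related_limit[OF fin])
    show "linearly_related F (\<lambda>x. sqmat (s x n) - lorentz_adjoint (sqmat (s x n)))" for n
    proof -
      interpret group_hom integer_group "SO0 :: (real ^ ('n option) ^ ('n option)) monoid" "\<rho> n"
        using hom by (simp add: group_hom_def group_hom_axioms_def group_SO0)
      define A where "A = sqmat (\<rho> n 1)"
      define B where "B = sqmat (\<rho> n (- 1))"
      have add: "sqmat (\<rho> n (a + b)) = sqmat (\<rho> n a) * sqmat (\<rho> n b)" for a b
        using hom_mult[of a b] by (simp add: SO0_def sqmat_mult)
      have zero: "sqmat (\<rho> n 0) = 1"
        using hom_one by (simp add: SO0_def sqmat_1)
      have AB: "A * B = 1" "B * A = 1"
        using add[of 1 "- 1"] add[of "- 1" 1] zero by (simp_all add: A_def B_def)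
      have "\<rho> n 1 \<in> SO_lorentz"
        by (intro carrier_SO0 hom_closed) simp
      then have "lorentz_adjoint A * A = 1"
        unfolding A_def by (rule lorentz_adjoint_inverse(1))
      then have "lorentz_adjoint A * (A * B) = B"
        by (simp flip: mult.assoc)
      then have adj: "lorentz_adjoint A = B"
        by (simp add: AB)
      have pos: "sqmat (\<rho> n (int k)) = A ^ k" for k
        by (induction k) (simp_all add: zero add A_def)
      have neg: "sqmat (\<rho> n (- int k)) = B ^ k" for k
      proof (induction k)
        case (Suc k)
        then show ?case
          using add[of "- 1" "- int k"] by (simp add: B_def)
      qed (simp add: zero)
      show ?thesis
      proof (rule cyclic_skew_family_related[where A=A and B=B and \<tau>=lorentz_adjoint])
        show "linear (lorentz_adjoint :: 'n option sqmat \<Rightarrow> _)"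
          using bounded_linear_lorentz_adjoint by (rule bounded_linear.linear)
        show "lorentz_adjoint B = A"
          using lorentz_adjoint_involution[of A] by (simp add: adj)
        fix x assume "x \<in> F"
        then obtain a where "s x n = \<rho> n a"
          using s(1) by blast
        then show "\<exists>k. sqmat (s x n) = A ^ k \<or> sqmat (s x n) = B ^ k"
          using pos neg by (metis int_cases2)
      qed (fact AB adj card lorentz_adjoint_mult)+
    qed
    fix x assume "x \<in> F"
    then have "(\<lambda>n. sqmat (s x n)) \<longlonglongrightarrow> x"
      using bounded_linear.tendsto[OF bounded_linear_sqmat s(2)[of x]] by (simp add: entries_inverse)
    then show "(\<lambda>n. sqmat (s x n) - lorentz_adjoint (sqmat (s x n))) \<longlonglongrightarrow> x - lorentz_adjoint x"
      by (intro tendsto_diff bounded_linear.tendsto[OF bounded_linear_lorentz_adjoint])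
  qed
qed

lemma limit_of_cyclic_groups_commute:
  fixes \<rho> :: "nat \<Rightarrow> int \<Rightarrow> real ^ ('n::finite option) ^ ('n option)"
  assumes hom: "\<And>n. \<rho> n \<in> hom integer_group SO0"
    and s: "\<And>n. s n \<in> range (\<rho> n)" "s \<longlonglongrightarrow> x" and t: "\<And>n. t n \<in> range (\<rho> n)" "t \<longlonglongrightarrow> y"
  shows "x ** y = y ** x"
proof -
  have "s n ** t n = t n ** s n" for n
  proof -
    obtain a b where "s n = \<rho> n a" "t n = \<rho> n b"
      using s(1) t(1) by blast
    then show ?thesis
      using hom_mult[OF hom[of n], of a b] hom_mult[OF hom[of n], of b a]
      by (simp add: SO0_def add.commute)
  qed
  then have eq: "sqmat (s n) * sqmat (t n) = sqmat (t n) * sqmat (s n)" for n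
    by (simp flip: sqmat_mult)
  have "(\<lambda>n. sqmat (s n) * sqmat (t n)) \<longlonglongrightarrow> sqmat x * sqmat y"
    by (intro tendsto_mult bounded_linear.tendsto[OF bounded_linear_sqmat] s t)
  moreover have "(\<lambda>n. sqmat (s n) * sqmat (t n)) \<longlonglongrightarrow> sqmat y * sqmat x"
    unfolding eq by (intro tendsto_mult bounded_linear.tendsto[OF bounded_linear_sqmat] s t)
  ultimately have "sqmat x * sqmat y = sqmat y * sqmat x"
    by (rule LIMSEQ_unique)
  then show ?thesis
    by (simp add: sqmat_eq_iff flip: sqmat_mult)
qed

theorem theorem2:
  fixes k :: nat
    and \<rho> :: "nat \<Rightarrow> int \<Rightarrow> real ^ ('n::finite option) ^ ('n option)"
    and \<Gamma> :: "(real ^ ('n option) ^ ('n option)) set"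
  assumes "k \<ge> 1"
    and "CARD('n) = k + 1"
    and "\<And>n. convex_cocompact (\<rho> n)"
    and "converges_geometrically SO0 (\<lambda>n. range (\<rho> n)) \<Gamma>"
    and "discrete \<Gamma>"
  shows "abelian_rank (SO0\<lparr>carrier := \<Gamma>\<rparr>) \<le> enat (nat \<lfloor>real k / 2\<rfloor> + 1)"
proof -
  let ?G = "SO0\<lparr>carrier := \<Gamma>\<rparr>"
  define d where "d = k div 2 + 1"
  have hom: "\<rho> n \<in> hom integer_group SO0" for n
    using assms(3)[of n] by (simp add: convex_cocompact_def)
  have sub: "subgroup \<Gamma> SO0"
    and lim: "\<And>h. h \<in> \<Gamma> \<Longrightarrow> \<exists>s. (\<forall>n. s n \<in> range (\<rho> n)) \<and> s \<longlonglongrightarrow> h"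
    using assms(4) by (simp_all add: converges_geometrically_def closed_subgroup_def)
  have \<Gamma>_SO: "h \<in> SO_lorentz" if "h \<in> \<Gamma>" for h
    using subgroup.mem_carrier[OF sub that] by (rule carrier_SO0)
  have comm: "x ** y = y ** x" if x: "x \<in> \<Gamma>" and y: "y \<in> \<Gamma>" for x y
  proof -
    obtain s where s: "\<And>n. s n \<in> range (\<rho> n)" "s \<longlonglongrightarrow> x"
      using lim[OF x] by blast
    obtain t where t: "\<And>n. t n \<in> range (\<rho> n)" "t \<longlonglongrightarrow> y"
      using lim[OF y] by blast
    show ?thesis
      using hom s t by (rule limit_of_cyclic_groups_commute)
  qed
  have "group ?G"
    using sub group_SO0 by (rule subgroup.subgroup_is_group)
  then have "comm_group ?G"
    by (rule group.group_comm_groupI) (simp add: SO0_def comm)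
  interpret G: comm_group ?G by fact
  have G_mult: "x \<otimes>\<^bsub>?G\<^esub> y = x ** y" and G_one: "\<one>\<^bsub>?G\<^esub> = mat 1" for x y
    by (simp_all add: SO0_def)
  have G_carrier: "carrier ?G = \<Gamma>"
    by simp
  have inv_adjoint: "sqmat (inv\<^bsub>?G\<^esub> x) = lorentz_adjoint (sqmat x)" if "x \<in> \<Gamma>" for x
  proof -
    have "inv\<^bsub>?G\<^esub> x \<otimes>\<^bsub>?G\<^esub> x = \<one>\<^bsub>?G\<^esub>"
      using that by (intro G.l_inv) simp
    then have "sqmat (inv\<^bsub>?G\<^esub> x) * sqmat x = 1"
      unfolding G_mult G_one by (simp add: sqmat_1 flip: sqmat_mult)
    then have "sqmat (inv\<^bsub>?G\<^esub> x) * (sqmat x * lorentz_adjoint (sqmat x)) = lorentz_adjoint (sqmat x)"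
      by (simp flip: mult.assoc)
    then show ?thesis
      by (simp add: lorentz_adjoint_inverse(2)[OF \<Gamma>_SO[OF that]])
  qed
  have int_pow_exp: "sqmat (x [^]\<^bsub>?G\<^esub> c) = exp (of_int c *\<^sub>R Y)" if x: "x \<in> \<Gamma>" "sqmat x = exp Y"
    for x Y and c :: int
  proof -
    have nat: "sqmat (x [^]\<^bsub>?G\<^esub> n) = exp (real n *\<^sub>R Y)" for n :: nat
    proof (induction n)
      case (Suc n)
      then show ?case
        by (simp only: G.nat_pow_Suc G_mult sqmat_mult x(2) exp_of_nat_scaleR power_Suc2)
    qed (simp add: G_one sqmat_1)
    show ?thesis
    proof (cases c rule: int_cases2)
      case (nonneg n)
      then show ?thesis
        by (simp add: int_pow_int nat)
    next
      case (nonpos n)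
      have y: "x [^]\<^bsub>?G\<^esub> n \<in> \<Gamma>"
        using G.nat_pow_closed[of x n] x(1) by simp
      have "x [^]\<^bsub>?G\<^esub> c = inv\<^bsub>?G\<^esub> (x [^]\<^bsub>?G\<^esub> n)"
        using x(1) by (simp add: nonpos G.int_pow_neg int_pow_int)
      then have "sqmat (x [^]\<^bsub>?G\<^esub> c) * exp (real n *\<^sub>R Y) = 1"
        using lorentz_adjoint_inverse(1)[OF \<Gamma>_SO[OF y]] by (simp only: inv_adjoint[OF y] nat)
      then have "sqmat (x [^]\<^bsub>?G\<^esub> c) = exp (- (real n *\<^sub>R Y))"
        by (rule right_inverse_exp)
      then show ?thesis
        by (simp add: nonpos)
    qed
  qed
  obtain K where K: "K > 0" "\<And>x :: 'n option sqmat. norm (entries x) \<le> norm x * K"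
    using bounded_linear.pos_bounded[OF bounded_linear_entries] by blast
  have one: "mat 1 \<in> \<Gamma>"
    using G.one_closed unfolding G_carrier G_one .
  obtain \<epsilon> where \<epsilon>: "\<epsilon> > 0" "\<And>y. y \<in> \<Gamma> \<Longrightarrow> dist (mat 1) y < \<epsilon> \<Longrightarrow> y = mat 1"
    using isolated_inE_dist[OF discreteD[OF assms(5) one]] by metis
  \<comment> \<open>Discreteness is about the norm of matrices; the constant \<open>K\<close> converts it to the operator norm.\<close>
  have near_one: "y = mat 1" if "y \<in> \<Gamma>" "norm (sqmat y - 1) < \<epsilon> / K" for y
  proof (rule \<epsilon>(2)[OF that(1)])
    have "y - mat 1 = entries (sqmat y - 1)"
      by (simp add: minus_sqmat.rep_eq one_sqmat.rep_eq sqmat_inverse)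
    then have "dist (mat 1) y \<le> norm (sqmat y - 1) * K"
      using K(2)[of "sqmat y - 1"] by (simp add: dist_norm norm_minus_commute)
    also have "\<dots> < \<epsilon>"
      using that(2) K(1) by (simp add: pos_less_divide_eq)
    finally show "dist (mat 1) y < \<epsilon>" .
  qed
  have "card S \<le> d" if S: "finite S" "S \<subseteq> \<Gamma>" "int_independent ?G S" for S
  proof (rule ccontr)
    assume "\<not> card S \<le> d"
    then have "d < card S"
      by simp
    have closed: "x ** y \<in> \<Gamma>" if "x \<in> \<Gamma>" "y \<in> \<Gamma>" for x y
      using G.m_closed[of x y] that unfolding G_carrier G_mult .
    have rel: "linearly_related F (\<lambda>x. x - lorentz_adjoint x)" if F: "F \<subseteq> sqmat ` \<Gamma>" "card F = Suc d"
      for F :: "'n option sqmat set"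
    proof (rule limit_of_cyclic_groups_related[OF hom])
      \<comment> \<open>With \<open>card F = k div 2 + 2\<close>, twice the cardinality is at least \<open>k + 3\<close>, one more than the matrix size.\<close>
      show "CARD('n option) < 2 * card F"
        using assms(2) F(2) by (simp add: d_def)
      fix x assume "x \<in> F"
      then have "entries x \<in> \<Gamma>"
        using F(1) by (auto simp: sqmat_inverse)
      then show "\<exists>s. (\<forall>n. s n \<in> range (\<rho> n)) \<and> s \<longlonglongrightarrow> entries x"
        by (rule lim)
    qed
    obtain X p c where p: "\<And>s. s \<in> S \<Longrightarrow> p s > 0" and X: "\<And>s. s \<in> S \<Longrightarrow> exp (X s) = sqmat s ^ p s"
      and X_comm: "\<And>s t. s \<in> S \<Longrightarrow> t \<in> S \<Longrightarrow> X s * X t = X t * X s"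
      and c: "\<exists>s\<in>S. c s \<noteq> 0" "norm (exp (\<Sum>s\<in>S. of_int (c s) *\<^sub>R X s) - 1) < \<epsilon> / K"
    proof (rule small_integer_relation_near_one[of "sqmat ` \<Gamma>" lorentz_adjoint d S sqmat "\<epsilon> / K"])
      show "1 \<in> sqmat ` \<Gamma>"
        using one sqmat_1 by (metis imageI)
      show "x * y \<in> sqmat ` \<Gamma>" "x * y = y * x" if "x \<in> sqmat ` \<Gamma>" "y \<in> sqmat ` \<Gamma>" for x y
        using that closed comm by (auto simp flip: sqmat_mult)
      show "lorentz_adjoint x \<in> sqmat ` \<Gamma>" "lorentz_adjoint x * x = 1" if x: "x \<in> sqmat ` \<Gamma>" for x
      proof -
        obtain y where y: "y \<in> \<Gamma>" "x = sqmat y"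
          using x by blast
        have "inv\<^bsub>?G\<^esub> y \<in> \<Gamma>"
          using G.inv_closed[of y] y(1) by simp
        then show "lorentz_adjoint x \<in> sqmat ` \<Gamma>"
          using inv_adjoint[OF y(1)] y(2) by (metis imageI)
        show "lorentz_adjoint x * x = 1"
          unfolding y(2) by (intro lorentz_adjoint_inverse \<Gamma>_SO y(1))
      qed
      show "sqmat s \<in> sqmat ` \<Gamma>" if "s \<in> S" for s
        using S(2) that by blast
      show "\<epsilon> / K > 0"
        using \<epsilon>(1) K(1) by simp
    qed (use bounded_linear_lorentz_adjoint lorentz_adjoint_mult rel S(1) \<open>d < card S\<close> in auto)
    \<comment> \<open>The logarithm belongs to \<open>s\<close> raised to \<open>p s\<close>, so \<open>c s\<close> times it belongs to the exponent \<open>p s * c s\<close>.\<close>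
    define m where "m s = int (p s) * c s" for s
    have pow: "sqmat (s [^]\<^bsub>?G\<^esub> m s) = exp (of_int (c s) *\<^sub>R X s)" if s: "s \<in> S" for s
    proof -
      have s\<Gamma>: "s \<in> carrier ?G"
        using s S(2) by auto
      have "sqmat (s [^]\<^bsub>?G\<^esub> q) = sqmat s ^ q" for q :: nat
      proof (induction q)
        case (Suc q)
        then show ?case
          by (simp only: G.nat_pow_Suc G_mult sqmat_mult power_Suc2)
      qed (simp add: G_one sqmat_1)
      then have "sqmat (s [^]\<^bsub>?G\<^esub> p s) = exp (X s)"
        by (simp add: X[OF s])
      moreover have "s [^]\<^bsub>?G\<^esub> p s \<in> \<Gamma>"
        using G.nat_pow_closed[OF s\<Gamma>] by simp
      moreover have "s [^]\<^bsub>?G\<^esub> m s = (s [^]\<^bsub>?G\<^esub> p s) [^]\<^bsub>?G\<^esub> c s"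
        using G.int_pow_pow[OF s\<Gamma>, of "int (p s)" "c s"] by (simp only: m_def int_pow_int)
      ultimately show ?thesis
        by (simp only: int_pow_exp)
    qed
    have mem: "(\<lambda>s. s [^]\<^bsub>?G\<^esub> m s) \<in> F \<rightarrow> carrier ?G" if "F \<subseteq> S" for F
      using that S(2) by (intro Pi_I G.int_pow_closed) auto
    have "sqmat (\<Otimes>\<^bsub>?G\<^esub>s\<in>F. s [^]\<^bsub>?G\<^esub> m s) = exp (\<Sum>s\<in>F. of_int (c s) *\<^sub>R X s)" if "finite F" "F \<subseteq> S" for F
      using that
    proof (induction F rule: finite_induct)
      case empty
      show ?case
        by (simp add: G_one sqmat_1)
    next
      case (insert s F)
      have s: "s \<in> S" and F: "F \<subseteq> S"
        using insert.prems by auto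
      have "(\<Otimes>\<^bsub>?G\<^esub>s\<in>insert s F. s [^]\<^bsub>?G\<^esub> m s) =
          s [^]\<^bsub>?G\<^esub> m s \<otimes>\<^bsub>?G\<^esub> (\<Otimes>\<^bsub>?G\<^esub>s\<in>F. s [^]\<^bsub>?G\<^esub> m s)"
        by (rule G.finprod_insert[OF insert.hyps mem[OF F]]) (use mem[OF insert.prems] in blast)
      then have "sqmat (\<Otimes>\<^bsub>?G\<^esub>s\<in>insert s F. s [^]\<^bsub>?G\<^esub> m s) =
          sqmat (s [^]\<^bsub>?G\<^esub> m s) * sqmat (\<Otimes>\<^bsub>?G\<^esub>s\<in>F. s [^]\<^bsub>?G\<^esub> m s)"
        by (simp only: G_mult sqmat_mult)
      also have "\<dots> = exp (of_int (c s) *\<^sub>R X s) * exp (\<Sum>s\<in>F. of_int (c s) *\<^sub>R X s)"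
        by (simp only: pow[OF s] insert.IH[OF F])
      also have "\<dots> = exp (of_int (c s) *\<^sub>R X s + (\<Sum>s\<in>F. of_int (c s) *\<^sub>R X s))"
      proof (rule exp_add_commuting[symmetric])
        show "of_int (c s) *\<^sub>R X s * (\<Sum>s\<in>F. of_int (c s) *\<^sub>R X s) =
            (\<Sum>s\<in>F. of_int (c s) *\<^sub>R X s) * of_int (c s) *\<^sub>R X s"
          unfolding sum_distrib_left sum_distrib_right
          using F by (intro sum.cong) (auto simp: X_comm[OF s] mult.commute)
      qed
      finally show ?case
        using insert.hyps by simp
    qed
    from this[OF S(1) order_refl] have "norm (sqmat (\<Otimes>\<^bsub>?G\<^esub>s\<in>S. s [^]\<^bsub>?G\<^esub> m s) - 1) < \<epsilon> / K"
      using c(2) by simp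
    moreover have "(\<Otimes>\<^bsub>?G\<^esub>s\<in>S. s [^]\<^bsub>?G\<^esub> m s) \<in> \<Gamma>"
      using G.finprod_closed[OF mem[OF order_refl]] by simp
    ultimately have "(\<Otimes>\<^bsub>?G\<^esub>s\<in>S. s [^]\<^bsub>?G\<^esub> m s) = \<one>\<^bsub>?G\<^esub>"
      unfolding G_one by (intro near_one)
    then have "\<forall>s\<in>S. m s = 0"
      using S(3)[unfolded int_independent_def, THEN spec[of _ m]] by blast
    then show False
      using c(1) p by (force simp: m_def)
  qed
  moreover have "nat \<lfloor>real k / 2\<rfloor> + 1 = d"
    using floor_divide_of_nat_eq[of k 2, where 'a = real] by (simp add: d_def)
  ultimately show ?thesis
    unfolding abelian_rank_def by (intro SUP_least) auto
qed

end
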